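(* The positive definite quadratic form $$Q^{c2}_6=Q_{\mathsf{E}_6^*}+\frac{\sqrt{1057}-1}{88}\,R_1$$ gives a locally optimal lattice covering. Its covering density is $$\Theta(Q^{c2}_6)=\frac{\sqrt{1124895337698\sqrt{1057}-33713139497730}}{3543122}\cdot\kappa_6\approx 2.466121650.$$
   Context: For a positive definite quadratic form (PQF) $Q$, i.e. a positive definite real symmetric $d\times d$ matrix with $Q[x]=x^tQx$, put $\mu(Q)=\max_{x\in\mathbb{R}^d}\min_{v\in\mathbb{Z}^d}Q[x-v]$ and $\Theta(Q)=\sqrt{\mu(Q)^d/\det Q}\cdot\kappa_d$, with $\kappa_d$ the volume of the $d$-dimensional unit ball. $Q$ gives a locally optimal lattice covering if $Q$ is a local minimum of $\Theta$ on the open cone of all PQFs in $d$ variables (equivalently, after scaling to $\mu(Q)=1$, a local maximum of $\det$ among PQFs with $\mu=1$). Here $$Q_{\mathsf{E}_6^*}=\begin{pmatrix}4&1&2&2&-1&1\\1&4&2&2&2&1\\2&2&4&1&1&2\\2&2&1&4&1&2\\-1&2&1&1&4&2\\1&1&2&2&2&4\end{pmatrix},\quad R_1=\begin{pmatrix}12&3&6&6&-3&3\\3&7&4&4&3&2\\6&4&8&3&1&4\\6&4&3&8&1&4\\-3&3&1&1&7&3\\3&2&4&4&3&7\end{pmatrix}.$$ *)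

theory Defs
  imports "HOL-Analysis.Analysis"
begin

definition qform :: "real^'n^'n \<Rightarrow> real^'n \<Rightarrow> real" where
  "qform Q x = x \<bullet> (Q *v x)"

definition PQF :: "(real^'n^'n) set" where
  "PQF = {Q. transpose Q = Q \<and> (\<forall>x. x \<noteq> 0 \<longrightarrow> qform Q x > 0)}"

definition int_lattice :: "(real^'n) set" where
  "int_lattice = {v. \<forall>i. v $ i \<in> \<int>}"

definition min_dist :: "real^'n^'n \<Rightarrow> real^'n \<Rightarrow> real" where
  "min_dist Q x = (INF v\<in>int_lattice. qform Q (x - v))"

text \<open>
  The infimum in \<^term>\<open>min_dist\<close> and the supremum in \<open>mu\<close> below are a minimum and a
  maximum whenever \<open>Q \<in> PQF\<close>; see \<open>min_dist_attained\<close> and \<open>mu_attained\<close>.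
\<close>

definition mu :: "real^'n^'n \<Rightarrow> real" where
  "mu Q = (SUP x. min_dist Q x)"

definition Theta :: "real^'n^'n \<Rightarrow> real" where
  "Theta Q = sqrt (mu Q ^ CARD('n) / det Q) * unit_ball_vol (real CARD('n))"

text \<open>
  Neighbourhoods are taken within the cone of PQFs, i.e. for the topology of the space of
  symmetric matrices, in which that cone is open. The minimum cannot be strict, as
  \<open>Theta\<close> is invariant under scaling of the form.
\<close>

definition locally_optimal_covering :: "real^'n^'n \<Rightarrow> bool" where
  "locally_optimal_covering Q \<longleftrightarrow>
     Q \<in> PQF \<and> (\<exists>\<epsilon>>0. \<forall>Q'\<in>PQF. dist Q' Q < \<epsilon> \<longrightarrow> Theta Q \<le> Theta Q')"

definition Q_E6_dual :: "real^6^6" where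
  "Q_E6_dual = vector
    [vector [ 4, 1, 2, 2, -1, 1],
     vector [ 1, 4, 2, 2,  2, 1],
     vector [ 2, 2, 4, 1,  1, 2],
     vector [ 2, 2, 1, 4,  1, 2],
     vector [-1, 2, 1, 1,  4, 2],
     vector [ 1, 1, 2, 2,  2, 4]]"

definition R1 :: "real^6^6" where
  "R1 = vector
    [vector [12, 3, 6, 6, -3, 3],
     vector [ 3, 7, 4, 4,  3, 2],
     vector [ 6, 4, 8, 3,  1, 4],
     vector [ 6, 4, 3, 8,  1, 4],
     vector [-3, 3, 1, 1,  7, 3],
     vector [ 3, 2, 4, 4,  3, 7]]"

definition Q6c2 :: "real^6^6" where
  "Q6c2 = Q_E6_dual + ((sqrt 1057 - 1) / 88) *\<^sub>R R1"

lemma qform_continuous: "continuous_on S (\<lambda>x. qform Q (f x))" if "continuous_on S f"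
  unfolding qform_def matrix_vector_mult_def inner_vec_def
  by (intro continuous_intros that)

lemma qform_scale: "qform Q (c *\<^sub>R x) = c\<^sup>2 * qform Q x"
  by (simp add: qform_def matrix_vector_mult_scaleR power2_eq_square)

lemma qform_nonneg: "qform Q x \<ge> 0" if "Q \<in> PQF"
  using that by (cases "x = 0") (auto simp: PQF_def qform_def less_imp_le)

lemma qform_coercive:
  fixes Q :: "real^'n^'n"
  assumes "Q \<in> PQF"
  obtains c where "c > 0" "\<And>x. c * (norm x)\<^sup>2 \<le> qform Q x"
proof -
  have "sphere (0::real^'n) 1 \<noteq> {}"
    by simp
  then obtain z where z: "z \<in> sphere 0 1" "\<And>y. y \<in> sphere 0 1 \<Longrightarrow> qform Q z \<le> qform Q y"
    using continuous_attains_inf[of "sphere 0 1" "qform Q"]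
      qform_continuous[OF continuous_on_id, of "sphere 0 1" Q] by auto
  have "qform Q z > 0"
  proof -
    have "z \<noteq> 0"
      using z(1) by auto
    then show ?thesis
      using assms by (simp add: PQF_def)
  qed
  moreover have "qform Q z * (norm x)\<^sup>2 \<le> qform Q x" for x
  proof (cases "x = 0")
    case False
    have "qform Q z \<le> qform Q ((1 / norm x) *\<^sub>R x)"
      using False by (intro z(2)) simp
    then show ?thesis
      using False unfolding qform_scale by (simp add: field_simps)
  qed (simp add: qform_def)
  ultimately show ?thesis
    using that by blast
qed

lemma int_lattice_zero: "0 \<in> int_lattice"
  by (simp add: int_lattice_def)

lemma closed_int_lattice: "closed (int_lattice :: (real^'n) set)"
proof -
  have "int_lattice = (\<Inter>i. (\<lambda>v::real^'n. v $ i) -` \<int>)"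
    by (auto simp: int_lattice_def)
  moreover have "closed ((\<lambda>v::real^'n. v $ i) -` \<int>)" for i
    by (intro continuous_closed_vimage closed_Ints) (auto intro!: continuous_intros)
  ultimately show ?thesis
    by (metis closed_INT)
qed

lemma qform_lattice_min:
  fixes Q :: "real^'n^'n"
  assumes "Q \<in> PQF"
  shows "\<exists>v\<in>int_lattice. \<forall>w\<in>int_lattice. qform Q (x - v) \<le> qform Q (x - w)"
proof -
  obtain c where c: "c > 0" "\<And>x. c * (norm x)\<^sup>2 \<le> qform Q x"
    using qform_coercive[OF assms] by blast
  define r where "r = sqrt (qform Q x / c)"
  have r0: "r \<ge> 0" "c * r\<^sup>2 = qform Q x"
    using c(1) qform_nonneg[OF assms] by (simp_all add: r_def)
  define S where "S = int_lattice \<inter> cball x (r + norm x)"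
  have "compact S"
    unfolding S_def by (simp add: closed_Int_compact closed_int_lattice)
  moreover have "0 \<in> S"
    using r0 by (simp add: S_def int_lattice_zero dist_norm)
  moreover have "continuous_on S (\<lambda>v. qform Q (x - v))"
    by (intro qform_continuous continuous_intros)
  ultimately obtain v where v: "v \<in> S" "\<And>w. w \<in> S \<Longrightarrow> qform Q (x - v) \<le> qform Q (x - w)"
    using continuous_attains_inf[of S "\<lambda>v. qform Q (x - v)"] by auto
  have "qform Q (x - v) \<le> qform Q (x - w)" if w: "w \<in> int_lattice" for w
  proof (cases "w \<in> S")
    case False
    then have "r \<le> norm (x - w)"
      using w norm_ge_zero[of x] unfolding S_def by (simp add: dist_norm del: norm_ge_zero)
    then have "c * r\<^sup>2 \<le> c * (norm (x - w))\<^sup>2"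
      using r0(1) c(1) by (intro mult_left_mono power_mono) auto
    then have "qform Q x \<le> qform Q (x - w)"
      using c(2)[of "x - w"] r0 by linarith
    then show ?thesis
      using v(2)[OF \<open>0 \<in> S\<close>] by simp
  qed (use v in auto)
  then show ?thesis
    using v(1) by (auto simp: S_def)
qed

lemma min_dist_le: "min_dist Q x \<le> qform Q (x - v)" if "Q \<in> PQF" "v \<in> int_lattice"
  unfolding min_dist_def
  by (rule cINF_lower) (use that qform_nonneg in \<open>auto intro!: bdd_belowI2[where m = 0]\<close>)

lemma min_dist_attained:
  assumes "Q \<in> PQF"
  shows "\<exists>v\<in>int_lattice. min_dist Q x = qform Q (x - v)"
proof -
  obtain v where v: "v \<in> int_lattice" "\<forall>w\<in>int_lattice. qform Q (x - v) \<le> qform Q (x - w)"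
    using qform_lattice_min[OF assms] by blast
  have "qform Q (x - v) \<le> min_dist Q x"
    unfolding min_dist_def by (rule cINF_greatest) (use v int_lattice_zero in auto)
  then show ?thesis
    using min_dist_le[OF assms v(1), of x] v(1) by (intro bexI[of _ v]) auto
qed

lemma min_dist_translate:
  assumes "Q \<in> PQF" "w \<in> int_lattice"
  shows "min_dist Q (x - w) = min_dist Q x"
proof -
  have le: "min_dist Q (y - u) \<le> min_dist Q y" if u: "u \<in> int_lattice" for y u
  proof -
    obtain v where v: "v \<in> int_lattice" "min_dist Q y = qform Q (y - v)"
      using min_dist_attained[OF assms(1)] by blast
    have "v - u \<in> int_lattice"
      using v u by (simp add: int_lattice_def)
    from min_dist_le[OF assms(1) this, of "y - u"] show ?thesis
      using v(2) by simp
  qed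
  have "- w \<in> int_lattice"
    using assms(2) by (simp add: int_lattice_def)
  from le[OF this, of "x - w"] le[OF assms(2), of x] show ?thesis
    by simp
qed

lemma mu_attained:
  fixes Q :: "real^'n^'n"
  assumes Q: "Q \<in> PQF"
  shows "\<exists>x. mu Q = min_dist Q x \<and> (\<forall>y. min_dist Q y \<le> min_dist Q x)"
proof -
  define C where "C = cbox (0::real^'n) 1"
  have "0 \<in> C"
    by (simp add: C_def mem_box_cart)
  obtain B where B: "\<And>x. x \<in> C \<Longrightarrow> qform Q x \<le> B"
    using continuous_attains_sup[of C "qform Q"] \<open>0 \<in> C\<close>
      qform_continuous[OF continuous_on_id, of C Q] by (force simp: C_def)
  have to_C: "\<exists>z\<in>C. min_dist Q z = min_dist Q y" for y
  proof -
    define w where "w = (\<chi> i. real_of_int \<lfloor>y $ i\<rfloor>)"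
    have "w \<in> int_lattice"
      by (simp add: w_def int_lattice_def)
    moreover have "y - w \<in> C"
      by (auto simp: C_def w_def mem_box_cart) linarith
    ultimately show ?thesis
      using min_dist_translate[OF Q] by blast
  qed
  have bdd: "bdd_above (range (min_dist Q))"
  proof (rule bdd_aboveI2)
    fix y
    obtain z where z: "z \<in> C" "min_dist Q z = min_dist Q y"
      using to_C by blast
    show "min_dist Q y \<le> B"
      using min_dist_le[OF Q int_lattice_zero, of z] B[OF z(1)] z(2) by simp
  qed
  then have le_mu: "min_dist Q y \<le> mu Q" for y
    unfolding mu_def by (rule cSUP_upper[OF UNIV_I])
  have "\<exists>z\<in>C. mu Q - 1 / Suc n < min_dist Q z" for n
  proof -
    have "mu Q - 1 / Suc n < mu Q"
      by simp
    then obtain y where "mu Q - 1 / Suc n < min_dist Q y"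
      unfolding mu_def using less_cSUP_iff[OF _ bdd] by auto
    then show ?thesis
      using to_C by metis
  qed
  then obtain X where X: "\<And>n. X n \<in> C" "\<And>n. mu Q - 1 / Suc n < min_dist Q (X n)"
    by metis
  have "seq_compact C"
    by (simp add: C_def compact_imp_seq_compact)
  then obtain x s where xs: "x \<in> C" "strict_mono s" "(X \<circ> s) \<longlonglongrightarrow> x"
    using X(1) by (metis seq_compactE)
  obtain v where v: "v \<in> int_lattice" "min_dist Q x = qform Q (x - v)"
    using min_dist_attained[OF Q] by blast
  have "continuous_on UNIV (\<lambda>y. qform Q (y - v))"
    by (intro qform_continuous continuous_intros)
  then have lim1: "(\<lambda>n. qform Q ((X \<circ> s) n - v)) \<longlonglongrightarrow> qform Q (x - v)"
    by (rule continuous_on_tendsto_compose[OF _ xs(3)]) auto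
  have "(\<lambda>n. mu Q - 1 / Suc n) \<longlonglongrightarrow> mu Q - 0"
    by (intro tendsto_diff tendsto_const LIMSEQ_Suc lim_1_over_n)
  then have lim2: "(\<lambda>n. mu Q - 1 / Suc (s n)) \<longlonglongrightarrow> mu Q"
    using LIMSEQ_subseq_LIMSEQ[OF _ xs(2), of "\<lambda>n. mu Q - 1 / Suc n"] by (simp add: o_def)
  have "mu Q \<le> qform Q (x - v)"
  proof (rule LIMSEQ_le[OF lim2 lim1], intro exI allI impI)
    fix n
    show "mu Q - 1 / Suc (s n) \<le> qform Q ((X \<circ> s) n - v)"
      using X(2)[of "s n"] min_dist_le[OF Q v(1), of "X (s n)"] by simp
  qed
  then have "mu Q = min_dist Q x"
    using le_mu[of x] v(2) by simp
  then show ?thesis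
    using le_mu by auto
qed

end

theory Submission
  imports Defs
begin

text \<open>
  In coordinates adapted to its automorphism group, \<^term>\<open>Q6c2\<close> is a multiple of
  $x_1^2 + \dots + x_5^2 + \tau x_6^2$ on the lattice of integer vectors whose entries have the
  same parity and a sum divisible by 4, where $231 \tau^2 = 70 \tau + 13$. Its Delaunay simplices
  are unimodular and form three orbits under the affine automorphism group.

  Upper bound for \<^term>\<open>mu\<close>: given a point, minimise its power with respect to the circumscribed
  ellipsoids of three representative simplices, over these simplices and over the orbit of the
  point. Minimality against the seven neighbouring simplices says exactly that the barycentric
  coordinates of the point are nonnegative; then the mean of the squared distances to the
  vertices, weighted by these coordinates, is at most the squared circumradius.

  Lower bound near \<^term>\<open>Q6c2\<close>: a simplex of largest circumradius remains a Delaunay simplex of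
  every form $P$ close to \<^term>\<open>Q6c2\<close>, and its squared circumradius with respect to $P$ is bounded
  below by a linear function of $P$. Averaging over the automorphism group replaces this function by
  a multiple of the trace of $Q^{-1} P$, which is where the equation for $\tau$ enters. Hadamard's
  inequality and the inequality of the arithmetic and geometric means then bound $\det P$.
\<close>

section \<open>The covering radius from above\<close>

text \<open>Near the form, \<open>mu\<close> is a maximum of many functions, one per Delaunay
  simplex, so it need not be smooth. A lower bound may use any of these functions, and one orbit of
  simplices, that of largest circumradius, already gives enough of them; the other two orbits matter
  only for the upper bound at the form itself. No derivatives are needed. For every fixed point,
  minus its power is at most the squared circumradius, with equality when the point is the
  circumcentre. Fixing the point at the centre belonging to the unperturbed form thus gives a bound
  that is linear in the form and exact at the form studied, so a first order condition suffices for
  a local minimum. After averaging, this condition is a single equation, because only two kinds of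
  coordinates remain. In the family \<open>Q_E6_dual\<close> + \<alpha> \<open>R1\<close> the value
  \<alpha> = 0 corresponds to \<open>tau\<close> = 1/3, and the positive root of the equation is
  reached at \<alpha> = (sqrt 1057 - 1) / 88.\<close>

definition tau :: real where
  "tau = (35 + 2 * sqrt 1057) / 231"

lemma tau_square: "231 * tau\<^sup>2 = 70 * tau + 13"
proof -
  have "(sqrt 1057)\<^sup>2 = (1057::real)"
    by simp
  then show ?thesis
    unfolding tau_def by (simp add: power2_eq_square field_simps)
qed

text \<open>The upper bound keeps the circumradius behind \<open>pow1\<close> below the largest one;
  the lower bound keeps \<open>6 * tau - 2\<close>, the smallest gap in \<open>pw_gap\<close>, above
  1/2.\<close>

lemma tau_bounds: "43 / 100 < tau" "tau < 11 / 25"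
proof -
  have "325 / 10 < sqrt 1057" "sqrt 1057 < 326 / 10"
    by (rule real_less_rsqrt real_less_lsqrt; simp add: power2_eq_square)+
  then show "43 / 100 < tau" "tau < 11 / 25"
    unfolding tau_def by simp_all
qed

text \<open>Largest squared circumradius of the three simplices, a quadratic polynomial in
  \<open>tau\<close> that the equation of \<open>tau\<close> makes linear; see
  \<open>rad_eq\<close>.\<close>

definition rad :: real where
  "rad = (39 - 21 * tau) / 11"

text \<open>
  Twice the lattice $D_6^+$. The last argument is the coordinate that carries the factor \<^term>\<open>tau\<close>.
\<close>

definition D6_plus :: "int \<Rightarrow> int \<Rightarrow> int \<Rightarrow> int \<Rightarrow> int \<Rightarrow> int \<Rightarrow> bool" where
  "D6_plus k l m n p q \<longleftrightarrow>
     even (k - q) \<and> even (l - q) \<and> even (m - q) \<and> even (n - q) \<and> even (p - q)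
     \<and> 4 dvd k + l + m + n + p + q"

definition nrm :: "real \<Rightarrow> real \<Rightarrow> real \<Rightarrow> real \<Rightarrow> real \<Rightarrow> real \<Rightarrow> real" where
  "nrm a b c d e z = a\<^sup>2 + b\<^sup>2 + c\<^sup>2 + d\<^sup>2 + e\<^sup>2 + tau * z\<^sup>2"

definition covered :: "real \<Rightarrow> real \<Rightarrow> real \<Rightarrow> real \<Rightarrow> real \<Rightarrow> real \<Rightarrow> bool" where
  "covered a b c d e z \<longleftrightarrow> (\<exists>k l m n p q. D6_plus k l m n p q \<and>
     nrm (a - of_int k) (b - of_int l) (c - of_int m) (d - of_int n) (e - of_int p) (z - of_int q) \<le> rad)"

lemma coveredI:
  assumes "D6_plus k l m n p q"
    "nrm (a - of_int k) (b - of_int l) (c - of_int m) (d - of_int n) (e - of_int p) (z - of_int q) \<le> rad"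
  shows "covered a b c d e z"
  using assms unfolding covered_def by blast

section \<open>Symmetries of the lattice and of the covering property\<close>

lemma D6_plus_flip45:
  assumes "D6_plus k l m n p q"
  shows "D6_plus k l m (- n) (- p) q"
proof -
  have "even (n + p)"
    using assms by (auto simp: D6_plus_def)
  \<comment> \<open>Reversing two signs changes the coordinate sum by twice an even number.
    Reversing a single sign would break the congruence at odd vectors, which is why signs change in
    pairs throughout.\<close>
  then have "4 dvd 2 * (n + p)"
    by presburger
  with assms have "4 dvd (k + l + m + n + p + q) - 2 * (n + p)"
    unfolding D6_plus_def by (metis dvd_diff)
  then have "4 dvd k + l + m + - n + - p + q"
    by (simp add: algebra_simps)
  then show ?thesis
    using assms by (auto simp: D6_plus_def)
qed

lemma D6_plus_flip56:
  assumes "D6_plus k l m n p q"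
  shows "D6_plus k l m n (- p) (- q)"
proof -
  have "even (p + q)"
    using assms by (auto simp: D6_plus_def)
  then have "4 dvd 2 * (p + q)"
    by presburger
  with assms have "4 dvd (k + l + m + n + p + q) - 2 * (p + q)"
    unfolding D6_plus_def by (metis dvd_diff)
  then have "4 dvd k + l + m + n + - p + - q"
    by (simp add: algebra_simps)
  then show ?thesis
    using assms by (auto simp: D6_plus_def)
qed

lemma D6_plus_diff:
  assumes "D6_plus k l m n p q" "D6_plus k' l' m' n' p' q'"
  shows "D6_plus (k - k') (l - l') (m - m') (n - n') (p - p') (q - q')"
proof -
  have "4 dvd (k + l + m + n + p + q) - (k' + l' + m' + n' + p' + q')"
    using assms unfolding D6_plus_def by (metis dvd_diff)
  then have "4 dvd (k - k') + (l - l') + (m - m') + (n - n') + (p - p') + (q - q')"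
    by (simp add: algebra_simps)
  then show ?thesis
    using assms by (auto simp: D6_plus_def)
qed

text \<open>Permutations of the five coordinates of weight 1 and paired sign changes preserve both
  the lattice and \<open>nrm\<close>, hence carry a close lattice point along. Adjacent
  transpositions and the two sign changes below generate all that is needed.\<close>

lemma covered_swap12:
  assumes "covered b a c d e z"
  shows "covered a b c d e z"
proof -
  obtain k l m n p q where "D6_plus k l m n p q"
    "nrm (b - of_int k) (a - of_int l) (c - of_int m) (d - of_int n) (e - of_int p) (z - of_int q) \<le> rad"
    using assms unfolding covered_def by blast
  then show ?thesis
    by (intro coveredI[of l k m n p q]) (auto simp: D6_plus_def nrm_def ac_simps)
qed

lemma covered_swap23:
  assumes "covered a c b d e z"
  shows "covered a b c d e z"
proof -
  obtain k l m n p q where "D6_plus k l m n p q"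
    "nrm (a - of_int k) (c - of_int l) (b - of_int m) (d - of_int n) (e - of_int p) (z - of_int q) \<le> rad"
    using assms unfolding covered_def by blast
  then show ?thesis
    by (intro coveredI[of k m l n p q]) (auto simp: D6_plus_def nrm_def ac_simps)
qed

lemma covered_swap34:
  assumes "covered a b d c e z"
  shows "covered a b c d e z"
proof -
  obtain k l m n p q where "D6_plus k l m n p q"
    "nrm (a - of_int k) (b - of_int l) (d - of_int m) (c - of_int n) (e - of_int p) (z - of_int q) \<le> rad"
    using assms unfolding covered_def by blast
  then show ?thesis
    by (intro coveredI[of k l n m p q]) (auto simp: D6_plus_def nrm_def ac_simps)
qed

lemma covered_swap45:
  assumes "covered a b c e d z"
  shows "covered a b c d e z"
proof -
  obtain k l m n p q where "D6_plus k l m n p q"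
    "nrm (a - of_int k) (b - of_int l) (c - of_int m) (e - of_int n) (d - of_int p) (z - of_int q) \<le> rad"
    using assms unfolding covered_def by blast
  then show ?thesis
    by (intro coveredI[of k l m p n q]) (auto simp: D6_plus_def nrm_def ac_simps)
qed

lemma covered_flip45:
  assumes "covered a b c (- d) (- e) z"
  shows "covered a b c d e z"
proof -
  obtain k l m n p q where D: "D6_plus k l m n p q" and N:
    "nrm (a - of_int k) (b - of_int l) (c - of_int m) (- d - of_int n) (- e - of_int p) (z - of_int q) \<le> rad"
    using assms unfolding covered_def by blast
  have "(d + n)\<^sup>2 = (- d - n)\<^sup>2" "(e + p)\<^sup>2 = (- e - p)\<^sup>2"
    by (simp_all add: power2_eq_square algebra_simps)
  with N show ?thesis
    by (intro coveredI[OF D6_plus_flip45[OF D]]) (simp add: nrm_def)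
qed

lemma covered_flip56:
  assumes "covered a b c d (- e) (- z)"
  shows "covered a b c d e z"
proof -
  obtain k l m n p q where D: "D6_plus k l m n p q" and N:
    "nrm (a - of_int k) (b - of_int l) (c - of_int m) (d - of_int n) (- e - of_int p) (- z - of_int q) \<le> rad"
    using assms unfolding covered_def by blast
  have "(z + q)\<^sup>2 = (- z - q)\<^sup>2" "(e + p)\<^sup>2 = (- e - p)\<^sup>2"
    by (simp_all add: power2_eq_square algebra_simps)
  with N show ?thesis
    by (intro coveredI[OF D6_plus_flip56[OF D]]) (simp add: nrm_def)
qed

lemma covered_translate:
  assumes "covered (a + of_int k) (b + of_int l) (c + of_int m) (d + of_int n) (e + of_int p) (z + of_int q)"
    and "D6_plus k l m n p q"
  shows "covered a b c d e z"
proof -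
  obtain k' l' m' n' p' q' where D: "D6_plus k' l' m' n' p' q'" and N:
    "nrm (a + of_int k - of_int k') (b + of_int l - of_int l') (c + of_int m - of_int m') (d + of_int n - of_int n') (e + of_int p - of_int p') (z + of_int q - of_int q') \<le> rad"
    using assms unfolding covered_def by blast
  show ?thesis
    by (rule coveredI[OF D6_plus_diff[OF D assms(2)]]) (use N in \<open>simp add: algebra_simps\<close>)
qed

text \<open>This lemma and the thirteen after it supply the automorphisms that lead across the
  facets of the three simplices, each written as a word in the generators above. Where constants
  occur, the word ends with a lattice translation.\<close>

lemma covered_image0: "covered (2 - d) b c (2 - a) e z \<Longrightarrow> covered a b c d e z"
  by (rule covered_swap12, rule covered_swap23, rule covered_flip45, rule covered_swap34,
    rule covered_swap23, rule covered_swap12, rule covered_flip45,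
    rule covered_translate[of _ 2 _ 0 _ 0 _ 2 _ 0 _ 0])
    (simp_all add: D6_plus_def)

lemma covered_image1: "covered a b c e d z \<Longrightarrow> covered a b c d e z"
  by (rule covered_swap45, simp)

lemma covered_image2: "covered a b c (- e) d (- z) \<Longrightarrow> covered a b c d e z"
  by (rule covered_flip56, rule covered_swap45, simp)

lemma covered_image3: "covered a b c d (- e) (- z) \<Longrightarrow> covered a b c d e z"
  by (rule covered_flip56, simp)

lemma covered_image4: "covered a b d c e z \<Longrightarrow> covered a b c d e z"
  by (rule covered_swap34, simp)

lemma covered_image5: "covered a d c b e z \<Longrightarrow> covered a b c d e z"
  by (rule covered_swap23, rule covered_swap34, rule covered_swap23, simp)

lemma covered_image6: "covered (d + 1) (a - 1) (1 - e) (1 - b) (1 - c) (1 - z) \<Longrightarrow> covered a b c d e z"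
  by (rule covered_swap34, rule covered_swap23, rule covered_swap12, rule covered_flip56,
    rule covered_swap45, rule covered_swap34, rule covered_flip45,
    rule covered_translate[of _ 1 _ "-1" _ 1 _ 1 _ 1 _ 1])
    (simp_all add: D6_plus_def)

lemma covered_image7: "covered a b c (- d) (- e) z \<Longrightarrow> covered a b c d e z"
  by (rule covered_flip45, simp)

lemma covered_image8: "covered (d + 1) (1 - e) (1 - c) (a - 1) (1 - b) (1 - z) \<Longrightarrow> covered a b c d e z"
  by (rule covered_swap23, rule covered_swap34, rule covered_swap23, rule covered_swap12,
    rule covered_flip56, rule covered_swap45, rule covered_swap34, rule covered_swap23,
    rule covered_flip45, rule covered_swap34,
    rule covered_translate[of _ 1 _ 1 _ 1 _ "-1" _ 1 _ 1])
    (simp_all add: D6_plus_def)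

lemma covered_image9: "covered (d + 1) (1 - b) (1 - e) (a - 1) (1 - c) (1 - z) \<Longrightarrow> covered a b c d e z"
  by (rule covered_swap23, rule covered_swap34, rule covered_swap23, rule covered_swap12,
    rule covered_flip45, rule covered_swap34, rule covered_swap23, rule covered_swap45,
    rule covered_swap34, rule covered_flip56,
    rule covered_translate[of _ 1 _ 1 _ 1 _ "-1" _ 1 _ 1])
    (simp_all add: D6_plus_def)

lemma covered_image10: "covered a (2 - b) (2 - c) d e z \<Longrightarrow> covered a b c d e z"
  by (rule covered_swap23, rule covered_swap34, rule covered_swap23, rule covered_flip45,
    rule covered_swap34, rule covered_swap23, rule covered_flip45, rule covered_swap34,
    rule covered_translate[of _ 0 _ 2 _ 2 _ 0 _ 0 _ 0])
    (simp_all add: D6_plus_def)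

lemma covered_image11: "covered a b c (- d) e (- z) \<Longrightarrow> covered a b c d e z"
  by (rule covered_flip45, rule covered_flip56, simp)

lemma covered_image12: "covered b a c d e z \<Longrightarrow> covered a b c d e z"
  by (rule covered_swap12, simp)

lemma covered_image13: "covered c b a d e z \<Longrightarrow> covered a b c d e z"
  by (rule covered_swap12, rule covered_swap23, rule covered_swap12, simp)

text \<open>
  The powers of a point with respect to the circumscribed ellipsoids of the three representative
  Delaunay simplices. The origin is a vertex of each of them, so there is no constant term.
\<close>

definition pow0 :: "real \<Rightarrow> real \<Rightarrow> real \<Rightarrow> real \<Rightarrow> real \<Rightarrow> real \<Rightarrow> real" where
  "pow0 a b c d e z = nrm a b c d e z
     - 2 * (1 + tau) * a - 2 * (1 - tau) * (b + c) - (3 * tau - 1) * d"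

definition pow1 :: "real \<Rightarrow> real \<Rightarrow> real \<Rightarrow> real \<Rightarrow> real \<Rightarrow> real \<Rightarrow> real" where
  "pow1 a b c d e z = nrm a b c d e z
     - ((5 + tau) * a + (3 - tau) * (b + c) + (3 * tau - 1) * (d + e + z)) / 2"

definition pow2 :: "real \<Rightarrow> real \<Rightarrow> real \<Rightarrow> real \<Rightarrow> real \<Rightarrow> real \<Rightarrow> real" where
  "pow2 a b c d e z = nrm a b c d e z - (3 - tau) * a - (1 + tau) * (b + c)"

section \<open>Circumradii of the three representative simplices\<close>

lemma rad_eq: "rad = 21 / 4 * tau\<^sup>2 - 7 / 2 * tau + 13 / 4"
proof -
  have "tau\<^sup>2 = (70 * tau + 13) / 231"
    using tau_square by simp
  then show ?thesis
    unfolding rad_def by (simp add: field_simps)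
qed

lemma pow0_ge: "- rad \<le> pow0 a b c d e z"
proof -
  have "pow0 a b c d e z + rad = (a - (1 + tau))\<^sup>2 + (b - (1 - tau))\<^sup>2 + (c - (1 - tau))\<^sup>2
      + (d - (3 * tau - 1) / 2)\<^sup>2 + e\<^sup>2 + tau * z\<^sup>2"
    unfolding rad_eq pow0_def nrm_def power2_eq_square by (simp add: field_simps)
  also have "\<dots> \<ge> 0"
    using tau_bounds by (intro add_nonneg_nonneg mult_nonneg_nonneg) simp_all
  finally show ?thesis
    by simp
qed

lemma pow1_ge: "- rad \<le> pow1 a b c d e z"
proof -
  have "tau > 0"
    using tau_bounds by simp
  have sq: "tau * tau = (70 * tau + 13) / 231"
    using tau_square by (simp add: power2_eq_square)
  \<comment> \<open>\<open>w\<close> is the weighted coordinate of the circumcentre. The equation of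
    \<open>tau\<close> clears the denominator of \<open>tau * w\<^sup>2\<close> = (3 tau - 1)^2 /
    (16 tau), which makes the circumradius comparable with \<open>rad\<close>.\<close>
  define w where "w = (3 * tau - 1) / (4 * tau)"
  have w: "tau * w = (3 * tau - 1) / 4"
    using \<open>tau > 0\<close> by (simp add: w_def)
  have "tau * (tau * w\<^sup>2) = (tau * w)\<^sup>2"
    by (simp add: power2_eq_square)
  also have "\<dots> = tau * ((87 * tau - 37) / 52)"
  proof -
    have "((3 * tau - 1) / 4)\<^sup>2 - tau * ((87 * tau - 37) / 52)
        = - (231 * (tau * tau) - 70 * tau - 13) / 208"
      by (simp add: power2_eq_square field_simps)
    also have "231 * (tau * tau) - 70 * tau - 13 = 0"
      using sq by simp
    finally show ?thesis
      unfolding w by simp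
  qed
  finally have w2: "tau * w\<^sup>2 = (87 * tau - 37) / 52"
    using \<open>tau > 0\<close> by simp
  have "tau * (z - w)\<^sup>2 = tau * z\<^sup>2 - 2 * (tau * w) * z + tau * w\<^sup>2"
    by (simp add: power2_eq_square algebra_simps)
  also have "\<dots> = tau * z\<^sup>2 - (3 * tau - 1) / 2 * z + (87 * tau - 37) / 52"
    unfolding w w2 by simp
  finally have "pow1 a b c d e z + (311 + 171 * tau) / 143
      = (a - (5 + tau) / 4)\<^sup>2 + (b - (3 - tau) / 4)\<^sup>2 + (c - (3 - tau) / 4)\<^sup>2
      + (d - (3 * tau - 1) / 4)\<^sup>2 + (e - (3 * tau - 1) / 4)\<^sup>2 + tau * (z - w)\<^sup>2"
    using sq unfolding pow1_def nrm_def power2_eq_square by (simp add: field_simps)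
  also have "\<dots> \<ge> 0"
    using tau_bounds by (intro add_nonneg_nonneg mult_nonneg_nonneg) simp_all
  \<comment> \<open>The squared circumradius falls short of \<open>rad\<close> by (196 - 444 tau) /
    143, which is positive since \<open>tau\<close> < 11/25.\<close>
  finally show ?thesis
    using tau_bounds unfolding rad_def by (simp add: field_simps)
qed

lemma pow2_ge: "- rad \<le> pow2 a b c d e z"
proof -
  have "pow2 a b c d e z + (215 / 77 - 3 / 11 * tau)
      = (a - (3 - tau) / 2)\<^sup>2 + (b - (1 + tau) / 2)\<^sup>2 + (c - (1 + tau) / 2)\<^sup>2
      + d\<^sup>2 + e\<^sup>2 + tau * z\<^sup>2"
    using tau_square unfolding pow2_def nrm_def power2_eq_square by (simp add: field_simps)
  also have "\<dots> \<ge> 0"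
    using tau_bounds by (intro add_nonneg_nonneg mult_nonneg_nonneg) simp_all
  finally show ?thesis
    using tau_bounds unfolding rad_def by (simp add: field_simps)
qed

section \<open>From nonnegative barycentric coordinates to coverage\<close>

lemma nonneg_factor:
  fixes s x y w :: real
  assumes "s * x = y - w" "w \<le> y" "0 < s"
  shows "0 \<le> x"
  using assms by (metis diff_ge_0_iff_ge zero_le_mult_iff not_less)

text \<open>If every vertex were farther away than \<open>rad\<close> allows, so would be the
  weighted mean; the inequality stays strict because weights with sum 1 are not all zero.\<close>

lemma covered_of_barycentric:
  fixes l0 l1 l2 l3 l4 l5 l6 :: real
  assumes "0 \<le> l0" "0 \<le> l1" "0 \<le> l2" "0 \<le> l3" "0 \<le> l4" "0 \<le> l5" "0 \<le> l6"
    and sum: "l0 + l1 + l2 + l3 + l4 + l5 + l6 = 1"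
    and D: "D6_plus k0 m0 n0 o0 p0 q0" "D6_plus k1 m1 n1 o1 p1 q1" "D6_plus k2 m2 n2 o2 p2 q2"
      "D6_plus k3 m3 n3 o3 p3 q3" "D6_plus k4 m4 n4 o4 p4 q4" "D6_plus k5 m5 n5 o5 p5 q5"
      "D6_plus k6 m6 n6 o6 p6 q6"
    and le: "l0 * nrm (a - of_int k0) (b - of_int m0) (c - of_int n0) (d - of_int o0) (e - of_int p0) (z - of_int q0)
      + l1 * nrm (a - of_int k1) (b - of_int m1) (c - of_int n1) (d - of_int o1) (e - of_int p1) (z - of_int q1)
      + l2 * nrm (a - of_int k2) (b - of_int m2) (c - of_int n2) (d - of_int o2) (e - of_int p2) (z - of_int q2)
      + l3 * nrm (a - of_int k3) (b - of_int m3) (c - of_int n3) (d - of_int o3) (e - of_int p3) (z - of_int q3)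
      + l4 * nrm (a - of_int k4) (b - of_int m4) (c - of_int n4) (d - of_int o4) (e - of_int p4) (z - of_int q4)
      + l5 * nrm (a - of_int k5) (b - of_int m5) (c - of_int n5) (d - of_int o5) (e - of_int p5) (z - of_int q5)
      + l6 * nrm (a - of_int k6) (b - of_int m6) (c - of_int n6) (d - of_int o6) (e - of_int p6) (z - of_int q6)
      \<le> rad"
  shows "covered a b c d e z"
proof (rule ccontr)
  assume not: "\<not> covered a b c d e z"
  have gt: "rad < nrm (a - of_int k) (b - of_int m) (c - of_int n) (d - of_int h) (e - of_int p) (z - of_int q)"
    if "D6_plus k m n h p q" for k m n h p q
    using not that coveredI by (meson not_less)
  have ge: "l * rad \<le> l * y" if "0 \<le> l" "rad < y" for l y :: real
    using that by (intro mult_left_mono) simp_all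
  have "\<exists>l\<in>{l0, l1, l2, l3, l4, l5, l6}. 0 < l"
  proof (rule ccontr)
    assume "\<not> ?thesis"
    then have "l0 + l1 + l2 + l3 + l4 + l5 + l6 \<le> 0"
      by (simp add: not_less)
    then show False
      using sum by simp
  qed
  have gt': "l * rad < l * y" if "0 < l" "rad < y" for l y :: real
    using that by simp
  have "(l0 + l1 + l2 + l3 + l4 + l5 + l6) * rad < rad"
    using \<open>\<exists>l\<in>_. 0 < l\<close> le
    unfolding distrib_right
    using ge[OF assms(1) gt[OF D(1)]] ge[OF assms(2) gt[OF D(2)]] ge[OF assms(3) gt[OF D(3)]]
      ge[OF assms(4) gt[OF D(4)]] ge[OF assms(5) gt[OF D(5)]] ge[OF assms(6) gt[OF D(6)]]
      ge[OF assms(7) gt[OF D(7)]] gt'[OF _ gt[OF D(1)]] gt'[OF _ gt[OF D(2)]]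
      gt'[OF _ gt[OF D(3)]] gt'[OF _ gt[OF D(4)]] gt'[OF _ gt[OF D(5)]] gt'[OF _ gt[OF D(6)]]
      gt'[OF _ gt[OF D(7)]]
    by (smt (verit, best) insertE emptyE)
  then show False
    using sum by simp
qed

text \<open>
  In the following lemmas the right-hand sides of the assumptions are the powers with respect to the
  seven facet neighbours of the simplex, each of which is mapped to a representative by an affine
  automorphism. The difference of the powers is a positive multiple of a barycentric coordinate.
\<close>

lemma covered_of_minimal0:
  assumes
    "pow0 a b c d e z \<le> pow0 (2 - d) b c (2 - a) e z"
    "pow0 a b c d e z \<le> pow0 a b c e d z"
    "pow0 a b c d e z \<le> pow0 a b c (- e) d (- z)"
    "pow0 a b c d e z \<le> pow1 a b c d e z"
    "pow0 a b c d e z \<le> pow1 a b c d (- e) (- z)"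
    "pow0 a b c d e z \<le> pow0 a b d c e z"
    "pow0 a b c d e z \<le> pow0 a d c b e z"
  shows "covered a b c d e z"
proof -
  have l0: "0 \<le> (2 - a - d) / 2"
  proof (rule nonneg_factor)
    \<comment> \<open>The difference of the powers is affine and vanishes on the common facet. The
      factors in these lemmas, \<open>6 - 10 * tau\<close>, \<open>6 * tau - 2\<close> and
      \<open>4 - 4 * tau\<close>, are positive for 1/3 < \<open>tau\<close> < 3/5. At 1/3, the case
      of \<open>Q_E6_dual\<close>, the second one vanishes and neighbouring simplices merge.\<close>
    show "(6 - 10 * tau) * ((2 - a - d) / 2) = pow0 (2 - d) b c (2 - a) e z - pow0 a b c d e z"
      unfolding pow0_def pow1_def pow2_def nrm_def power2_eq_square by (simp add: field_simps)
  qed (use assms(1) tau_bounds in simp_all)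
  have l1: "0 \<le> (d - e) / 2"
  proof (rule nonneg_factor)
    show "(6 * tau - 2) * ((d - e) / 2) = pow0 a b c e d z - pow0 a b c d e z"
      unfolding pow0_def pow1_def pow2_def nrm_def power2_eq_square by (simp add: field_simps)
  qed (use assms(2) tau_bounds in simp_all)
  have l2: "0 \<le> (d + e) / 2"
  proof (rule nonneg_factor)
    show "(6 * tau - 2) * ((d + e) / 2) = pow0 a b c (- e) d (- z) - pow0 a b c d e z"
      unfolding pow0_def pow1_def pow2_def nrm_def power2_eq_square by (simp add: field_simps)
  qed (use assms(3) tau_bounds in simp_all)
  have l3: "0 \<le> (a + d - b - c - e - z) / 4"
  proof (rule nonneg_factor)
    show "(6 * tau - 2) * ((a + d - b - c - e - z) / 4) = pow1 a b c d e z - pow0 a b c d e z"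
      unfolding pow0_def pow1_def pow2_def nrm_def power2_eq_square by (simp add: field_simps)
  qed (use assms(4) tau_bounds in simp_all)
  have l4: "0 \<le> (a + d + e + z - b - c) / 4"
  proof (rule nonneg_factor)
    show "(6 * tau - 2) * ((a + d + e + z - b - c) / 4) = pow1 a b c d (- e) (- z) - pow0 a b c d e z"
      unfolding pow0_def pow1_def pow2_def nrm_def power2_eq_square by (simp add: field_simps)
  qed (use assms(5) tau_bounds in simp_all)
  have l5: "0 \<le> (c - d) / 2"
  proof (rule nonneg_factor)
    show "(6 - 10 * tau) * ((c - d) / 2) = pow0 a b d c e z - pow0 a b c d e z"
      unfolding pow0_def pow1_def pow2_def nrm_def power2_eq_square by (simp add: field_simps)
  qed (use assms(6) tau_bounds in simp_all)
  have l6: "0 \<le> (b - d) / 2"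
  proof (rule nonneg_factor)
    show "(6 - 10 * tau) * ((b - d) / 2) = pow0 a d c b e z - pow0 a b c d e z"
      unfolding pow0_def pow1_def pow2_def nrm_def power2_eq_square by (simp add: field_simps)
  qed (use assms(7) tau_bounds in simp_all)
  show ?thesis
  proof (rule covered_of_barycentric[OF l0 l1 l2 l3 l4 l5 l6])
    show "(2 - a - d) / 2 + (d - e) / 2 + (d + e) / 2 + (a + d - b - c - e - z) / 4 + (a + d + e + z - b - c) / 4 + (c - d) / 2 + (b - d) / 2 = 1"
      by (simp add: field_simps)
    show "D6_plus 0 0 0 0 0 0"
      by (simp add: D6_plus_def)
    show "D6_plus 1 1 1 1 (- 1) 1"
      by (simp add: D6_plus_def)
    show "D6_plus 1 1 1 1 1 (- 1)"
      by (simp add: D6_plus_def)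
    show "D6_plus 2 0 0 0 0 (- 2)"
      by (simp add: D6_plus_def)
    show "D6_plus 2 0 0 0 0 2"
      by (simp add: D6_plus_def)
    show "D6_plus 2 0 2 0 0 0"
      by (simp add: D6_plus_def)
    show "D6_plus 2 2 0 0 0 0"
      by (simp add: D6_plus_def)
    \<comment> \<open>The power vanishes at the vertices and differs from \<open>nrm\<close> by an
      affine function, so the weighted mean of the squared distances to the vertices is minus the
      power of the point.\<close>
    have "(2 - a - d) / 2 * nrm (a - of_int 0) (b - of_int 0) (c - of_int 0) (d - of_int 0) (e - of_int 0) (z - of_int 0)
      + (d - e) / 2 * nrm (a - of_int 1) (b - of_int 1) (c - of_int 1) (d - of_int 1) (e - of_int (- 1)) (z - of_int 1)
      + (d + e) / 2 * nrm (a - of_int 1) (b - of_int 1) (c - of_int 1) (d - of_int 1) (e - of_int 1) (z - of_int (- 1))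
      + (a + d - b - c - e - z) / 4 * nrm (a - of_int 2) (b - of_int 0) (c - of_int 0) (d - of_int 0) (e - of_int 0) (z - of_int (- 2))
      + (a + d + e + z - b - c) / 4 * nrm (a - of_int 2) (b - of_int 0) (c - of_int 0) (d - of_int 0) (e - of_int 0) (z - of_int 2)
      + (c - d) / 2 * nrm (a - of_int 2) (b - of_int 0) (c - of_int 2) (d - of_int 0) (e - of_int 0) (z - of_int 0)
      + (b - d) / 2 * nrm (a - of_int 2) (b - of_int 2) (c - of_int 0) (d - of_int 0) (e - of_int 0) (z - of_int 0)
      = - pow0 a b c d e z"
      unfolding pow0_def nrm_def power2_eq_square by (simp add: field_simps)
    also have "\<dots> \<le> rad"
      using pow0_ge[of a b c d e z] by simp
    finally show "(2 - a - d) / 2 * nrm (a - of_int 0) (b - of_int 0) (c - of_int 0) (d - of_int 0) (e - of_int 0) (z - of_int 0)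
      + (d - e) / 2 * nrm (a - of_int 1) (b - of_int 1) (c - of_int 1) (d - of_int 1) (e - of_int (- 1)) (z - of_int 1)
      + (d + e) / 2 * nrm (a - of_int 1) (b - of_int 1) (c - of_int 1) (d - of_int 1) (e - of_int 1) (z - of_int (- 1))
      + (a + d - b - c - e - z) / 4 * nrm (a - of_int 2) (b - of_int 0) (c - of_int 0) (d - of_int 0) (e - of_int 0) (z - of_int (- 2))
      + (a + d + e + z - b - c) / 4 * nrm (a - of_int 2) (b - of_int 0) (c - of_int 0) (d - of_int 0) (e - of_int 0) (z - of_int 2)
      + (c - d) / 2 * nrm (a - of_int 2) (b - of_int 0) (c - of_int 2) (d - of_int 0) (e - of_int 0) (z - of_int 0)
      + (b - d) / 2 * nrm (a - of_int 2) (b - of_int 2) (c - of_int 0) (d - of_int 0) (e - of_int 0) (z - of_int 0)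
      \<le> rad" .
  qed
qed

lemma covered_of_minimal1:
  assumes
    "pow1 a b c d e z \<le> pow1 (d + 1) (a - 1) (1 - e) (1 - b) (1 - c) (1 - z)"
    "pow1 a b c d e z \<le> pow0 a b c d e z"
    "pow1 a b c d e z \<le> pow0 a b c e d z"
    "pow1 a b c d e z \<le> pow1 a b c (- d) (- e) z"
    "pow1 a b c d e z \<le> pow2 a b c d e z"
    "pow1 a b c d e z \<le> pow1 (d + 1) (1 - e) (1 - c) (a - 1) (1 - b) (1 - z)"
    "pow1 a b c d e z \<le> pow1 (d + 1) (1 - b) (1 - e) (a - 1) (1 - c) (1 - z)"
  shows "covered a b c d e z"
proof -
  have l0: "0 \<le> (4 - a - b - c - d - e - z) / 4"
  proof (rule nonneg_factor)
    show "(4 - 4 * tau) * ((4 - a - b - c - d - e - z) / 4) = pow1 (d + 1) (a - 1) (1 - e) (1 - b) (1 - c) (1 - z) - pow1 a b c d e z"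
      unfolding pow0_def pow1_def pow2_def nrm_def power2_eq_square by (simp add: field_simps)
  qed (use assms(1) tau_bounds in simp_all)
  have l1: "0 \<le> (b + c + e + z - a - d) / 4"
  proof (rule nonneg_factor)
    show "(6 * tau - 2) * ((b + c + e + z - a - d) / 4) = pow0 a b c d e z - pow1 a b c d e z"
      unfolding pow0_def pow1_def pow2_def nrm_def power2_eq_square by (simp add: field_simps)
  qed (use assms(2) tau_bounds in simp_all)
  have l2: "0 \<le> (b + c + d + z - a - e) / 4"
  proof (rule nonneg_factor)
    show "(6 * tau - 2) * ((b + c + d + z - a - e) / 4) = pow0 a b c e d z - pow1 a b c d e z"
      unfolding pow0_def pow1_def pow2_def nrm_def power2_eq_square by (simp add: field_simps)
  qed (use assms(3) tau_bounds in simp_all)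
  have l3: "0 \<le> (d + e) / 2"
  proof (rule nonneg_factor)
    show "(6 * tau - 2) * ((d + e) / 2) = pow1 a b c (- d) (- e) z - pow1 a b c d e z"
      unfolding pow0_def pow1_def pow2_def nrm_def power2_eq_square by (simp add: field_simps)
  qed (use assms(4) tau_bounds in simp_all)
  have l4: "0 \<le> (a + d + e + z - b - c) / 4"
  proof (rule nonneg_factor)
    show "(6 * tau - 2) * ((a + d + e + z - b - c) / 4) = pow2 a b c d e z - pow1 a b c d e z"
      unfolding pow0_def pow1_def pow2_def nrm_def power2_eq_square by (simp add: field_simps)
  qed (use assms(5) tau_bounds in simp_all)
  have l5: "0 \<le> (a + c - b - d - e - z) / 4"
  proof (rule nonneg_factor)
    show "(4 - 4 * tau) * ((a + c - b - d - e - z) / 4) = pow1 (d + 1) (1 - e) (1 - c) (a - 1) (1 - b) (1 - z) - pow1 a b c d e z"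
      unfolding pow0_def pow1_def pow2_def nrm_def power2_eq_square by (simp add: field_simps)
  qed (use assms(6) tau_bounds in simp_all)
  have l6: "0 \<le> (a + b - c - d - e - z) / 4"
  proof (rule nonneg_factor)
    show "(4 - 4 * tau) * ((a + b - c - d - e - z) / 4) = pow1 (d + 1) (1 - b) (1 - e) (a - 1) (1 - c) (1 - z) - pow1 a b c d e z"
      unfolding pow0_def pow1_def pow2_def nrm_def power2_eq_square by (simp add: field_simps)
  qed (use assms(7) tau_bounds in simp_all)
  show ?thesis
  proof (rule covered_of_barycentric[OF l0 l1 l2 l3 l4 l5 l6])
    show "(4 - a - b - c - d - e - z) / 4 + (b + c + e + z - a - d) / 4 + (b + c + d + z - a - e) / 4 + (d + e) / 2 + (a + d + e + z - b - c) / 4 + (a + c - b - d - e - z) / 4 + (a + b - c - d - e - z) / 4 = 1"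
      by (simp add: field_simps)
    show "D6_plus 0 0 0 0 0 0"
      by (simp add: D6_plus_def)
    show "D6_plus 1 1 1 (- 1) 1 1"
      by (simp add: D6_plus_def)
    show "D6_plus 1 1 1 1 (- 1) 1"
      by (simp add: D6_plus_def)
    show "D6_plus 1 1 1 1 1 (- 1)"
      by (simp add: D6_plus_def)
    show "D6_plus 2 0 0 0 0 2"
      by (simp add: D6_plus_def)
    show "D6_plus 2 0 2 0 0 0"
      by (simp add: D6_plus_def)
    show "D6_plus 2 2 0 0 0 0"
      by (simp add: D6_plus_def)
    have "(4 - a - b - c - d - e - z) / 4 * nrm (a - of_int 0) (b - of_int 0) (c - of_int 0) (d - of_int 0) (e - of_int 0) (z - of_int 0)
      + (b + c + e + z - a - d) / 4 * nrm (a - of_int 1) (b - of_int 1) (c - of_int 1) (d - of_int (- 1)) (e - of_int 1) (z - of_int 1)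
      + (b + c + d + z - a - e) / 4 * nrm (a - of_int 1) (b - of_int 1) (c - of_int 1) (d - of_int 1) (e - of_int (- 1)) (z - of_int 1)
      + (d + e) / 2 * nrm (a - of_int 1) (b - of_int 1) (c - of_int 1) (d - of_int 1) (e - of_int 1) (z - of_int (- 1))
      + (a + d + e + z - b - c) / 4 * nrm (a - of_int 2) (b - of_int 0) (c - of_int 0) (d - of_int 0) (e - of_int 0) (z - of_int 2)
      + (a + c - b - d - e - z) / 4 * nrm (a - of_int 2) (b - of_int 0) (c - of_int 2) (d - of_int 0) (e - of_int 0) (z - of_int 0)
      + (a + b - c - d - e - z) / 4 * nrm (a - of_int 2) (b - of_int 2) (c - of_int 0) (d - of_int 0) (e - of_int 0) (z - of_int 0)
      = - pow1 a b c d e z"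
      unfolding pow1_def nrm_def power2_eq_square by (simp add: field_simps)
    also have "\<dots> \<le> rad"
      using pow1_ge[of a b c d e z] by simp
    finally show "(4 - a - b - c - d - e - z) / 4 * nrm (a - of_int 0) (b - of_int 0) (c - of_int 0) (d - of_int 0) (e - of_int 0) (z - of_int 0)
      + (b + c + e + z - a - d) / 4 * nrm (a - of_int 1) (b - of_int 1) (c - of_int 1) (d - of_int (- 1)) (e - of_int 1) (z - of_int 1)
      + (b + c + d + z - a - e) / 4 * nrm (a - of_int 1) (b - of_int 1) (c - of_int 1) (d - of_int 1) (e - of_int (- 1)) (z - of_int 1)
      + (d + e) / 2 * nrm (a - of_int 1) (b - of_int 1) (c - of_int 1) (d - of_int 1) (e - of_int 1) (z - of_int (- 1))
      + (a + d + e + z - b - c) / 4 * nrm (a - of_int 2) (b - of_int 0) (c - of_int 0) (d - of_int 0) (e - of_int 0) (z - of_int 2)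
      + (a + c - b - d - e - z) / 4 * nrm (a - of_int 2) (b - of_int 0) (c - of_int 2) (d - of_int 0) (e - of_int 0) (z - of_int 0)
      + (a + b - c - d - e - z) / 4 * nrm (a - of_int 2) (b - of_int 2) (c - of_int 0) (d - of_int 0) (e - of_int 0) (z - of_int 0)
      \<le> rad" .
  qed
qed

lemma covered_of_minimal2:
  assumes
    "pow2 a b c d e z \<le> pow2 a (2 - b) (2 - c) d e z"
    "pow2 a b c d e z \<le> pow1 a b c d e z"
    "pow2 a b c d e z \<le> pow1 a b c d (- e) (- z)"
    "pow2 a b c d e z \<le> pow1 a b c (- d) e (- z)"
    "pow2 a b c d e z \<le> pow1 a b c (- d) (- e) z"
    "pow2 a b c d e z \<le> pow2 b a c d e z"
    "pow2 a b c d e z \<le> pow2 c b a d e z"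
  shows "covered a b c d e z"
proof -
  have l0: "0 \<le> (2 - b - c) / 2"
  proof (rule nonneg_factor)
    show "(4 - 4 * tau) * ((2 - b - c) / 2) = pow2 a (2 - b) (2 - c) d e z - pow2 a b c d e z"
      unfolding pow0_def pow1_def pow2_def nrm_def power2_eq_square by (simp add: field_simps)
  qed (use assms(1) tau_bounds in simp_all)
  have l1: "0 \<le> (b + c - a - d - e - z) / 4"
  proof (rule nonneg_factor)
    show "(6 * tau - 2) * ((b + c - a - d - e - z) / 4) = pow1 a b c d e z - pow2 a b c d e z"
      unfolding pow0_def pow1_def pow2_def nrm_def power2_eq_square by (simp add: field_simps)
  qed (use assms(2) tau_bounds in simp_all)
  have l2: "0 \<le> (b + c + e + z - a - d) / 4"
  proof (rule nonneg_factor)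
    show "(6 * tau - 2) * ((b + c + e + z - a - d) / 4) = pow1 a b c d (- e) (- z) - pow2 a b c d e z"
      unfolding pow0_def pow1_def pow2_def nrm_def power2_eq_square by (simp add: field_simps)
  qed (use assms(3) tau_bounds in simp_all)
  have l3: "0 \<le> (b + c + d + z - a - e) / 4"
  proof (rule nonneg_factor)
    show "(6 * tau - 2) * ((b + c + d + z - a - e) / 4) = pow1 a b c (- d) e (- z) - pow2 a b c d e z"
      unfolding pow0_def pow1_def pow2_def nrm_def power2_eq_square by (simp add: field_simps)
  qed (use assms(4) tau_bounds in simp_all)
  have l4: "0 \<le> (b + c + d + e - a - z) / 4"
  proof (rule nonneg_factor)
    show "(6 * tau - 2) * ((b + c + d + e - a - z) / 4) = pow1 a b c (- d) (- e) z - pow2 a b c d e z"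
      unfolding pow0_def pow1_def pow2_def nrm_def power2_eq_square by (simp add: field_simps)
  qed (use assms(5) tau_bounds in simp_all)
  have l5: "0 \<le> (a - b) / 2"
  proof (rule nonneg_factor)
    show "(4 - 4 * tau) * ((a - b) / 2) = pow2 b a c d e z - pow2 a b c d e z"
      unfolding pow0_def pow1_def pow2_def nrm_def power2_eq_square by (simp add: field_simps)
  qed (use assms(6) tau_bounds in simp_all)
  have l6: "0 \<le> (a - c) / 2"
  proof (rule nonneg_factor)
    show "(4 - 4 * tau) * ((a - c) / 2) = pow2 c b a d e z - pow2 a b c d e z"
      unfolding pow0_def pow1_def pow2_def nrm_def power2_eq_square by (simp add: field_simps)
  qed (use assms(7) tau_bounds in simp_all)
  show ?thesis
  proof (rule covered_of_barycentric[OF l0 l1 l2 l3 l4 l5 l6])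
    show "(2 - b - c) / 2 + (b + c - a - d - e - z) / 4 + (b + c + e + z - a - d) / 4 + (b + c + d + z - a - e) / 4 + (b + c + d + e - a - z) / 4 + (a - b) / 2 + (a - c) / 2 = 1"
      by (simp add: field_simps)
    show "D6_plus 0 0 0 0 0 0"
      by (simp add: D6_plus_def)
    show "D6_plus 1 1 1 (- 1) (- 1) (- 1)"
      by (simp add: D6_plus_def)
    show "D6_plus 1 1 1 (- 1) 1 1"
      by (simp add: D6_plus_def)
    show "D6_plus 1 1 1 1 (- 1) 1"
      by (simp add: D6_plus_def)
    show "D6_plus 1 1 1 1 1 (- 1)"
      by (simp add: D6_plus_def)
    show "D6_plus 2 0 2 0 0 0"
      by (simp add: D6_plus_def)
    show "D6_plus 2 2 0 0 0 0"
      by (simp add: D6_plus_def)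
    have "(2 - b - c) / 2 * nrm (a - of_int 0) (b - of_int 0) (c - of_int 0) (d - of_int 0) (e - of_int 0) (z - of_int 0)
      + (b + c - a - d - e - z) / 4 * nrm (a - of_int 1) (b - of_int 1) (c - of_int 1) (d - of_int (- 1)) (e - of_int (- 1)) (z - of_int (- 1))
      + (b + c + e + z - a - d) / 4 * nrm (a - of_int 1) (b - of_int 1) (c - of_int 1) (d - of_int (- 1)) (e - of_int 1) (z - of_int 1)
      + (b + c + d + z - a - e) / 4 * nrm (a - of_int 1) (b - of_int 1) (c - of_int 1) (d - of_int 1) (e - of_int (- 1)) (z - of_int 1)
      + (b + c + d + e - a - z) / 4 * nrm (a - of_int 1) (b - of_int 1) (c - of_int 1) (d - of_int 1) (e - of_int 1) (z - of_int (- 1))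
      + (a - b) / 2 * nrm (a - of_int 2) (b - of_int 0) (c - of_int 2) (d - of_int 0) (e - of_int 0) (z - of_int 0)
      + (a - c) / 2 * nrm (a - of_int 2) (b - of_int 2) (c - of_int 0) (d - of_int 0) (e - of_int 0) (z - of_int 0)
      = - pow2 a b c d e z"
      unfolding pow2_def nrm_def power2_eq_square by (simp add: field_simps)
    also have "\<dots> \<le> rad"
      using pow2_ge[of a b c d e z] by simp
    finally show "(2 - b - c) / 2 * nrm (a - of_int 0) (b - of_int 0) (c - of_int 0) (d - of_int 0) (e - of_int 0) (z - of_int 0)
      + (b + c - a - d - e - z) / 4 * nrm (a - of_int 1) (b - of_int 1) (c - of_int 1) (d - of_int (- 1)) (e - of_int (- 1)) (z - of_int (- 1))
      + (b + c + e + z - a - d) / 4 * nrm (a - of_int 1) (b - of_int 1) (c - of_int 1) (d - of_int (- 1)) (e - of_int 1) (z - of_int 1)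
      + (b + c + d + z - a - e) / 4 * nrm (a - of_int 1) (b - of_int 1) (c - of_int 1) (d - of_int 1) (e - of_int (- 1)) (z - of_int 1)
      + (b + c + d + e - a - z) / 4 * nrm (a - of_int 1) (b - of_int 1) (c - of_int 1) (d - of_int 1) (e - of_int 1) (z - of_int (- 1))
      + (a - b) / 2 * nrm (a - of_int 2) (b - of_int 0) (c - of_int 2) (d - of_int 0) (e - of_int 0) (z - of_int 0)
      + (a - c) / 2 * nrm (a - of_int 2) (b - of_int 2) (c - of_int 0) (d - of_int 0) (e - of_int 0) (z - of_int 0)
      \<le> rad" .
  qed
qed

section \<open>Minimising the power over an orbit\<close>

lemma pow_coercive:
  assumes "pow0 a b c d e z \<le> C \<or> pow1 a b c d e z \<le> C \<or> pow2 a b c d e z \<le> C"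
  shows "nrm a b c d e z \<le> 2 * C + 60"
proof -
  \<comment> \<open>Half of the quadratic part absorbs each linear term at a cost of 9/2. Six terms
    cost 27, rounded up to 30.\<close>
  have sq: "s * r \<le> r\<^sup>2 / 2 + 9 / 2" if "\<bar>s\<bar> \<le> 3" for s r :: real
  proof -
    have "s * r \<le> \<bar>s\<bar> * \<bar>r\<bar>"
      by (metis abs_ge_self abs_mult)
    also have "\<dots> \<le> 3 * \<bar>r\<bar>"
      using that by (intro mult_right_mono) simp_all
    also have "\<dots> \<le> r\<^sup>2 / 2 + 9 / 2"
      using zero_le_power2[of "\<bar>r\<bar> - 3"] by (simp add: power2_eq_square algebra_simps)
    finally show ?thesis .
  qed
  have sqz: "(3 * tau - 1) / 2 * z \<le> tau * z\<^sup>2 / 2 + 9 / 2"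
  proof -
    have "(3 * tau - 1) / (2 * tau) * z \<le> z\<^sup>2 / 2 + 9 / 2"
      using tau_bounds by (intro sq) (simp add: abs_le_iff field_simps)
    then have "tau * ((3 * tau - 1) / (2 * tau) * z) \<le> tau * (z\<^sup>2 / 2 + 9 / 2)"
      using tau_bounds by (intro mult_left_mono) simp_all
    also have "\<dots> \<le> tau * z\<^sup>2 / 2 + 9 / 2"
      using tau_bounds by (simp add: distrib_left)
    finally show ?thesis
      using tau_bounds by simp
  qed
  define Z where "Z = tau * z\<^sup>2"
  have "0 \<le> Z" "0 \<le> d\<^sup>2" "0 \<le> e\<^sup>2"
    using tau_bounds by (simp_all add: Z_def)
  moreover have "nrm a b c d e z / 2 - 30 + (e\<^sup>2 / 2 + Z / 2) \<le> pow0 a b c d e z"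
  proof -
    have "\<bar>2 * (1 + tau)\<bar> \<le> 3" "\<bar>2 * (1 - tau)\<bar> \<le> 3" "\<bar>3 * tau - 1\<bar> \<le> 3"
      using tau_bounds by (simp_all add: abs_le_iff)
    note S = this[THEN sq]
    show ?thesis
      using S(1)[of a] S(2)[of b] S(2)[of c] S(3)[of d]
      unfolding pow0_def nrm_def Z_def
      by (simp add: algebra_simps add_divide_distrib diff_divide_distrib)
  qed
  moreover have "nrm a b c d e z / 2 - 30 \<le> pow1 a b c d e z"
  proof -
    have "\<bar>(5 + tau) / 2\<bar> \<le> 3" "\<bar>(3 - tau) / 2\<bar> \<le> 3" "\<bar>(3 * tau - 1) / 2\<bar> \<le> 3"
      using tau_bounds by (simp_all add: abs_le_iff)
    note S = this[THEN sq]
    show ?thesis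
      using S(1)[of a] S(2)[of b] S(2)[of c] S(3)[of d] S(3)[of e] sqz
      unfolding pow1_def nrm_def
      by (simp add: algebra_simps add_divide_distrib diff_divide_distrib)
  qed
  moreover have "nrm a b c d e z / 2 - 30 + (d\<^sup>2 / 2 + e\<^sup>2 / 2 + Z / 2) \<le> pow2 a b c d e z"
  proof -
    have "\<bar>3 - tau\<bar> \<le> 3" "\<bar>1 + tau\<bar> \<le> 3"
      using tau_bounds by (simp_all add: abs_le_iff)
    note S = this[THEN sq]
    show ?thesis
      using S(1)[of a] S(2)[of b] S(2)[of c]
      unfolding pow2_def nrm_def Z_def
      by (simp add: algebra_simps add_divide_distrib diff_divide_distrib)
  qed
  ultimately show ?thesis
    using assms by - (elim disjE; linarith)
qed

lemma finite_bounded_cosets: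
  fixes X :: "real set"
  assumes "finite X"
  shows "finite {r. (\<exists>y\<in>X. \<exists>n::int. r = y + of_int n) \<and> \<bar>r\<bar> \<le> B}"
proof (rule finite_subset)
  show "{r. (\<exists>y\<in>X. \<exists>n::int. r = y + of_int n) \<and> \<bar>r\<bar> \<le> B}
      \<subseteq> (\<Union>y\<in>X. (\<lambda>n. y + of_int n) ` {\<lfloor>- B - y\<rfloor>..\<lceil>B - y\<rceil>})"
  proof (clarify, rule UN_I, assumption, rule imageI)
    fix y :: real and n :: int
    assume "\<bar>y + of_int n\<bar> \<le> B"
    then show "n \<in> {\<lfloor>- B - y\<rfloor>..\<lceil>B - y\<rceil>}"
      unfolding atLeastAtMost_iff by linarith
  qed
qed (use assms in simp)

text \<open>The descent needs no tiling theorem: the coordinates of all images lie in finitely many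
  cosets of the integers, and coercivity leaves finitely many candidates below the initial power, so
  a minimum is attained.\<close>

lemma covered_all: "covered a b c d e z"
proof -
  define X where "X = {a, b, c, d, e, z, - a, - b, - c, - d, - e, - z}"
  define W where "W = {r. \<exists>y\<in>X. \<exists>n::int. r = y + of_int n}"
  have W_uminus: "- r \<in> W" if r: "r \<in> W" for r
  proof -
    obtain y and n :: int where "y \<in> X" "r = y + of_int n"
      using r unfolding W_def mem_Collect_eq by blast
    then have "- y \<in> X" "- r = - y + of_int (- n)"
      by (auto simp: X_def)
    then show ?thesis
      unfolding W_def by blast
  qed
  have W_add: "r + of_int m \<in> W" if r: "r \<in> W" for r and m :: int
  proof -
    obtain y and n :: int where "y \<in> X" "r = y + of_int n"
      using r unfolding W_def mem_Collect_eq by blast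
    then have "y \<in> X" "r + of_int m = y + of_int (n + m)"
      by auto
    then show ?thesis
      unfolding W_def by blast
  qed
  have W_shift: "r + 1 \<in> W" "r - 1 \<in> W" "1 - r \<in> W" "2 - r \<in> W" if "r \<in> W" for r
    using W_add[OF that, of 1] W_add[OF that, of "-1"] W_add[OF W_uminus[OF that], of 1]
      W_add[OF W_uminus[OF that], of 2] by simp_all
  \<comment> \<open>A substitute for membership in the orbit of the given point: it records the
    cosets and the implication back to that point, and is therefore closed under the images without
    a group being defined.\<close>
  define good where "good = (\<lambda>(a', b', c', d', e', z').
    {a', b', c', d', e', z'} \<subseteq> W \<and> (covered a' b' c' d' e' z' \<longrightarrow> covered a b c d e z))"
  define h where "h = (\<lambda>(a, b, c, d, e, z).
    min (pow0 a b c d e z) (min (pow1 a b c d e z) (pow2 a b c d e z)))"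
  \<comment> \<open>\<open>K\<close> bounds the sum of the squared coordinates: \<open>tau\<close> <
    1 makes \<open>tau\<close> times this sum at most \<open>nrm\<close>, which coercivity bounds by
    \<open>tau * K\<close>.\<close>
  define K where "K = (2 * h (a, b, c, d, e, z) + 60) / tau"
  define F where "F = {p. good p \<and> h p \<le> h (a, b, c, d, e, z)}"
  have good0: "good (a, b, c, d, e, z)"
  proof -
    have "X \<subseteq> W"
    proof
      fix y
      assume "y \<in> X"
      moreover have "y = y + of_int 0"
        by simp
      ultimately show "y \<in> W"
        unfolding W_def by blast
    qed
    then show ?thesis
      by (auto simp: good_def X_def)
  qed
  have "finite F"
  proof -
    define V where "V = {r. (\<exists>y\<in>X. \<exists>n::int. r = y + of_int n) \<and> \<bar>r\<bar> \<le> K + 1}"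
    have "finite V"
      unfolding V_def by (rule finite_bounded_cosets) (simp add: X_def)
    moreover have "F \<subseteq> V \<times> V \<times> V \<times> V \<times> V \<times> V"
    proof
      fix p
      assume "p \<in> F"
      obtain a' b' c' d' e' z' where p: "p = (a', b', c', d', e', z')"
        by (cases p)
      have "nrm a' b' c' d' e' z' \<le> tau * K"
        using pow_coercive[of a' b' c' d' e' z' "h (a, b, c, d, e, z)"] \<open>p \<in> F\<close> tau_bounds
        unfolding F_def p K_def by (auto simp: h_def min_def split: if_splits)
      moreover have le: "tau * r\<^sup>2 \<le> r\<^sup>2" for r
        using tau_bounds by (simp add: mult_left_le_one_le)
      ultimately have "tau * (a'\<^sup>2 + b'\<^sup>2 + c'\<^sup>2 + d'\<^sup>2 + e'\<^sup>2 + z'\<^sup>2) \<le> tau * K"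
        using le[of a'] le[of b'] le[of c'] le[of d'] le[of e'] unfolding nrm_def distrib_left by linarith
      then have "a'\<^sup>2 + b'\<^sup>2 + c'\<^sup>2 + d'\<^sup>2 + e'\<^sup>2 + z'\<^sup>2 \<le> K"
        using tau_bounds by simp
      moreover have "\<bar>r\<bar> \<le> K + 1" if "r\<^sup>2 \<le> K" for r
      proof -
        have "0 \<le> (\<bar>r\<bar> - 1 / 2)\<^sup>2"
          by simp
        then have "\<bar>r\<bar> \<le> r\<^sup>2 + 1"
          by (simp add: power2_eq_square algebra_simps)
        with that show ?thesis
          by simp
      qed
      ultimately have "\<bar>a'\<bar> \<le> K + 1 \<and> \<bar>b'\<bar> \<le> K + 1 \<and> \<bar>c'\<bar> \<le> K + 1 \<and> \<bar>d'\<bar> \<le> K + 1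
          \<and> \<bar>e'\<bar> \<le> K + 1 \<and> \<bar>z'\<bar> \<le> K + 1"
        by (smt (verit) zero_le_power2)
      then show "p \<in> V \<times> V \<times> V \<times> V \<times> V \<times> V"
        using \<open>p \<in> F\<close> unfolding F_def p V_def good_def W_def by auto
    qed
    ultimately show ?thesis
      by (meson finite_SigmaI finite_subset)
  qed
  moreover have "(a, b, c, d, e, z) \<in> F"
    using good0 by (simp add: F_def)
  ultimately obtain p where p: "is_arg_min h (\<lambda>p. p \<in> F) p"
    using ex_is_arg_min_if_finite[of F h] by blast
  obtain a' b' c' d' e' z' where p_eq: "p = (a', b', c', d', e', z')"
    by (cases p)
  have "good p" "h p \<le> h (a, b, c, d, e, z)"
    using p by (auto simp: is_arg_min_def F_def)
  have min: "h p \<le> h q" if "good q" for q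
    using p that \<open>h p \<le> h (a, b, c, d, e, z)\<close> 
    unfolding is_arg_min_linorder F_def mem_Collect_eq by (metis linear order_trans)
  have min3: "h p \<le> pow0 a b c d e z" "h p \<le> pow1 a b c d e z" "h p \<le> pow2 a b c d e z"
    if "good (a, b, c, d, e, z)" for a b c d e z
    using min[OF that] by (auto simp: h_def)
  have W': "a' \<in> W" "b' \<in> W" "c' \<in> W" "d' \<in> W" "e' \<in> W" "z' \<in> W"
    and cov: "covered a' b' c' d' e' z' \<Longrightarrow> covered a b c d e z"
    using \<open>good p\<close> by (auto simp: good_def p_eq)
  have goodI: "good (a1, b1, c1, d1, e1, z1)"
    if "{a1, b1, c1, d1, e1, z1} \<subseteq> W" "covered a1 b1 c1 d1 e1 z1 \<Longrightarrow> covered a' b' c' d' e' z'"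
    for a1 b1 c1 d1 e1 z1
    using that cov by (auto simp: good_def)
  \<comment> \<open>The fourth entry is the point itself; it serves at facets where the neighbour is
    another representative simplex.\<close>
  have images:
    "good (2 - d', b', c', 2 - a', e', z')"
    "good (a', b', c', e', d', z')"
    "good (a', b', c', - e', d', - z')"
    "good (a', b', c', d', e', z')"
    "good (a', b', c', d', - e', - z')"
    "good (a', b', d', c', e', z')"
    "good (a', d', c', b', e', z')"
    "good (d' + 1, a' - 1, 1 - e', 1 - b', 1 - c', 1 - z')"
    "good (a', b', c', - d', - e', z')"
    "good (d' + 1, 1 - e', 1 - c', a' - 1, 1 - b', 1 - z')"
    "good (d' + 1, 1 - b', 1 - e', a' - 1, 1 - c', 1 - z')"
    "good (a', 2 - b', 2 - c', d', e', z')"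
    "good (a', b', c', - d', e', - z')"
    "good (b', a', c', d', e', z')"
    "good (c', b', a', d', e', z')"
    by (rule goodI goodI[OF _ covered_image0]
      goodI[OF _ covered_image1]
      goodI[OF _ covered_image2]
      goodI[OF _ covered_image3]
      goodI[OF _ covered_image4]
      goodI[OF _ covered_image5]
      goodI[OF _ covered_image6]
      goodI[OF _ covered_image7]
      goodI[OF _ covered_image8]
      goodI[OF _ covered_image9]
      goodI[OF _ covered_image10]
      goodI[OF _ covered_image11]
      goodI[OF _ covered_image12]
      goodI[OF _ covered_image13];
      simp add: W' W_uminus W_shift)+
  note bounds = images[THEN min3(1)] images[THEN min3(2)] images[THEN min3(3)]
  consider "h p = pow0 a' b' c' d' e' z'" | "h p = pow1 a' b' c' d' e' z'"
    | "h p = pow2 a' b' c' d' e' z'"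
  proof -
    have "h p = pow0 a' b' c' d' e' z' \<or> h p = pow1 a' b' c' d' e' z' \<or> h p = pow2 a' b' c' d' e' z'"
      by (simp add: p_eq h_def min_def)
    then show ?thesis
      using that by blast
  qed
  then have "covered a' b' c' d' e' z'"
  proof cases
    case 1
    then show ?thesis
      by (intro covered_of_minimal0) (use bounds in \<open>simp_all only:\<close>)
  next
    case 2
    then show ?thesis
      by (intro covered_of_minimal1) (use bounds in \<open>simp_all only:\<close>)
  next
    case 3
    then show ?thesis
      by (intro covered_of_minimal2) (use bounds in \<open>simp_all only:\<close>)
  qed
  then show ?thesis
    by (rule cov)
qed

section \<open>Positive definite forms\<close>

lemma UNIV_6: "UNIV = {1, 2, 3, 4, 5, 6::6}"
proof -
  have "card {1, 2, 3, 4, 5, 6::6} = card (UNIV :: 6 set)"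
    by simp
  then show ?thesis
    by (metis card_subset_eq finite subset_UNIV)
qed

lemma exhaust_6: "i = 1 \<or> i = 2 \<or> i = 3 \<or> i = 4 \<or> i = 5 \<or> i = 6" for i :: 6
  using UNIV_I[of i] unfolding UNIV_6 by simp

lemma forall_6: "(\<forall>i::6. P i) \<longleftrightarrow> P 1 \<and> P 2 \<and> P 3 \<and> P 4 \<and> P 5 \<and> P 6"
  by (metis exhaust_6)

lemma sum_6: "sum f (UNIV :: 6 set) = f 1 + f 2 + f 3 + f 4 + f 5 + f 6"
  unfolding UNIV_6 by (simp add: ac_simps)

lemma prod_6: "prod f (UNIV :: 6 set) = f 1 * f 2 * f 3 * f 4 * f 5 * f 6"
  unfolding UNIV_6 by (simp add: ac_simps)

lemma vector_6:
  "(vector [a, b, c, d, e, f] :: 'a::zero^6) $ 1 = a"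
  "(vector [a, b, c, d, e, f] :: 'a::zero^6) $ 2 = b"
  "(vector [a, b, c, d, e, f] :: 'a::zero^6) $ 3 = c"
  "(vector [a, b, c, d, e, f] :: 'a::zero^6) $ 4 = d"
  "(vector [a, b, c, d, e, f] :: 'a::zero^6) $ 5 = e"
  "(vector [a, b, c, d, e, f] :: 'a::zero^6) $ 6 = f"
  by (simp_all add: vector_def)

text \<open>A nonzero term of the determinant forces \<open>r i \<le> r (p i)\<close> for all
  \<open>i\<close>. Both sides have the same sum, so \<open>p\<close> preserves ranks and is the
  identity. Ordering by a rank allows any finite index type, and lower triangular matrices through a
  reversed rank.\<close>

lemma det_upper_triangular_rank:
  fixes A :: "'a::comm_ring_1^'n^'n" and r :: "'n \<Rightarrow> nat"
  assumes r: "inj r" and A: "\<And>i j. r j < r i \<Longrightarrow> A $ i $ j = 0"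
  shows "det A = (\<Prod>i\<in>UNIV. A $ i $ i)"
proof -
  have "(\<Prod>i\<in>UNIV. A $ i $ p i) = 0" if p: "p permutes UNIV" "p \<noteq> id" for p
  proof (rule ccontr)
    assume "(\<Prod>i\<in>UNIV. A $ i $ p i) \<noteq> 0"
    then have "A $ i $ p i \<noteq> 0" for i
      by (metis (mono_tags, lifting) UNIV_I finite prod_zero)
    then have le: "r i \<le> r (p i)" for i
      using A[of "p i" i] by (meson not_le)
    have "(\<Sum>i\<in>UNIV. r i) = (\<Sum>i\<in>UNIV. r (p i))"
      using sum.permute[OF p(1), of r] by (simp add: o_def)
    then have "r i = r (p i)" for i
      using le by (intro sum_mono_inv[of r UNIV "\<lambda>i. r (p i)" i]) auto
    then have "p i = i" for i
      using r by (metis injD)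
    then show False
      using p(2) by (auto simp: fun_eq_iff)
  qed
  then have "det A = (\<Sum>p\<in>{id}. of_int (sign p) * (\<Prod>i\<in>UNIV. A $ i $ p i))"
    unfolding det_def by (intro sum.mono_neutral_right) (auto simp: permutes_id)
  then show ?thesis
    by (simp add: sign_id)
qed

section \<open>Congruence, elimination and Hadamard's inequality\<close>

lemma qform_sum: "qform P x = (\<Sum>i\<in>UNIV. \<Sum>j\<in>UNIV. x $ i * P $ i $ j * x $ j)"
  unfolding qform_def inner_vec_def matrix_vector_mult_def by (simp add: sum_distrib_left mult.assoc)

lemma qform_congruence: "qform (transpose U ** P ** U) x = qform P (U *v x)"
  unfolding qform_def
  by (metis dot_lmul_matrix matrix_vector_mul_assoc vector_transpose_matrix)

lemma PQF_congruence:
  assumes "P \<in> PQF" and inj: "\<And>x. U *v x = 0 \<Longrightarrow> x = 0"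
  shows "transpose U ** P ** U \<in> PQF"
  using assms by (auto simp: PQF_def qform_congruence matrix_transpose_mul matrix_mul_assoc)

lemma PQF_diagonal_pos:
  assumes "P \<in> PQF"
  shows "0 < P $ i $ i"
proof -
  have "qform P (axis i 1) = P $ i $ i"
    by (simp add: qform_def inner_axis' matrix_vector_mult_basis column_def)
  then show ?thesis
    using assms by (auto simp: PQF_def axis_eq_0_iff dest: spec[of _ "axis i 1"])
qed

text \<open>Gaussian elimination only decreases the diagonal, which is why Hadamard's inequality holds.\<close>

lemma PQF_eliminate:
  fixes P :: "real^'n^'n" and k :: 'n
  assumes P: "P \<in> PQF"
  defines "P' \<equiv> \<chi> i j. if i = k \<or> j = k then (if i = j then P $ k $ k else 0)
      else P $ i $ j - P $ i $ k * P $ k $ j / P $ k $ k"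
  shows "P' \<in> PQF" "det P' = det P" "\<And>i. P' $ i $ i \<le> P $ i $ i"
proof -
  define u where "u i = (if i = k then 0 else - P $ k $ i / P $ k $ k)" for i
  define U where "U = (\<chi> i j. (if i = j then 1 else 0) + (if i = k then u j else 0))"
  have pos: "0 < P $ k $ k"
    using PQF_diagonal_pos[OF P] .
  have sym: "P $ i $ j = P $ j $ i" for i j
    using P by (auto simp: PQF_def transpose_def vec_eq_iff)
  have detU: "det U = 1"
  proof -
    obtain f :: "'n \<Rightarrow> nat" where "inj f"
      using finite_imp_inj_to_nat_seg[of "UNIV :: 'n set"] by auto
    \<comment> \<open>Only row \<open>k\<close> of \<open>U\<close> has off-diagonal entries, so
      ranking \<open>k\<close> lowest makes \<open>U\<close> upper triangular.\<close>
    then have "det U = (\<Prod>i\<in>UNIV. U $ i $ i)"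
      by (intro det_upper_triangular_rank[of "\<lambda>i. if i = k then 0 else Suc (f i)"])
        (auto simp: U_def inj_def split: if_splits)
    then show ?thesis
      by (simp add: U_def u_def cong: if_cong)
  qed
  have PU: "(P ** U) $ i $ j = P $ i $ j + P $ i $ k * u j" for i j
    unfolding matrix_matrix_mult_def U_def
    by (simp add: distrib_left sum.distrib if_distrib[of "\<lambda>x. _ * x"] cong: if_cong)
  have UX: "(transpose U ** X) $ i $ j = X $ i $ j + u i * X $ k $ j" for X :: "real^'n^'n" and i j
    unfolding matrix_matrix_mult_def U_def transpose_def
    by (simp add: distrib_right sum.distrib if_distrib[of "\<lambda>x. x * _"] cong: if_cong)
  have "(transpose U ** (P ** U)) $ i $ j = P' $ i $ j" for i j
    unfolding UX PU P'_def u_def using pos by (simp add: sym[of k i] sym[of j k] field_simps)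
  then have P'_eq: "P' = transpose U ** P ** U"
    by (simp add: vec_eq_iff matrix_mul_assoc)
  show "P' \<in> PQF"
    unfolding P'_eq
  proof (rule PQF_congruence[OF P])
    fix x
    assume "U *v x = 0"
    have "invertible U"
      using detU by (simp add: invertible_det_nz)
    then show "x = 0"
      using \<open>U *v x = 0\<close> by (metis matrix_left_invertible_ker invertible_def)
  qed
  show "det P' = det P"
    unfolding P'_eq by (simp add: det_mul detU)
  show "P' $ i $ i \<le> P $ i $ i" for i
    using pos by (simp add: P'_def sym[of k i] zero_le_divide_iff)
qed

text \<open>Eliminating one more index keeps cleared rows clear: in such a row \<open>i\<close> the
  correction term contains the factor \<open>P' $ i $ k\<close>, which is already zero.\<close>

lemma PQF_diagonalize:
  fixes P :: "real^'n^'n"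
  assumes "P \<in> PQF"
  shows "\<exists>P'\<in>PQF. det P' = det P \<and> (\<forall>i. P' $ i $ i \<le> P $ i $ i) \<and> (\<forall>i j. j \<noteq> i \<longrightarrow> P' $ i $ j = 0)"
proof -
  have "\<exists>P'\<in>PQF. det P' = det P \<and> (\<forall>i. P' $ i $ i \<le> P $ i $ i) \<and> (\<forall>i\<in>S. \<forall>j. j \<noteq> i \<longrightarrow> P' $ i $ j = 0)"
    if "finite S" for S :: "'n set"
    using that
  proof induction
    case empty
    then show ?case
      using assms by auto
  next
    case (insert k S)
    then obtain P' where P': "P' \<in> PQF" "det P' = det P" "\<And>i. P' $ i $ i \<le> P $ i $ i"
      "\<And>i j. i \<in> S \<Longrightarrow> j \<noteq> i \<Longrightarrow> P' $ i $ j = 0"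
      by blast
    define P'' where "P'' = (\<chi> i j. if i = k \<or> j = k then (if i = j then P' $ k $ k else 0)
      else P' $ i $ j - P' $ i $ k * P' $ k $ j / P' $ k $ k)"
    note P'' = PQF_eliminate[OF P'(1), of k, folded P''_def]
    have "P'' $ i $ i \<le> P $ i $ i" for i
      using P''(3) P'(3) order_trans by blast
    moreover have "P'' $ i $ j = 0" if "i \<in> insert k S" "j \<noteq> i" for i j
      using that P'(4)[of i] by (auto simp: P''_def)
    ultimately show ?case
      using P'' P'(2) by (intro bexI[of _ P'']) auto
  qed
  from this[of UNIV] show ?thesis
    by simp
qed

lemma PQF_det_pos:
  fixes P :: "real^'n^'n"
  assumes "P \<in> PQF"
  shows "0 < det P"
proof -
  obtain P' :: "real^'n^'n" where P': "P' \<in> PQF" "det P' = det P" "\<And>i j. j \<noteq> i \<Longrightarrow> P' $ i $ j = 0"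
    using PQF_diagonalize[OF assms] by auto
  have "det P' = (\<Prod>i\<in>UNIV. P' $ i $ i)"
    using P'(3) by (intro det_diagonal) metis
  also have "\<dots> > 0"
    using PQF_diagonal_pos[OF P'(1)] by (intro prod_pos) simp
  finally show ?thesis
    unfolding P'(2) .
qed

lemma PQF_det_le_prod_diagonal:
  fixes P :: "real^'n^'n"
  assumes "P \<in> PQF"
  shows "det P \<le> (\<Prod>i\<in>UNIV. P $ i $ i)"
proof -
  obtain P' where P': "P' \<in> PQF" "det P' = det P" "\<And>i. P' $ i $ i \<le> P $ i $ i"
    "\<And>i j. j \<noteq> i \<Longrightarrow> P' $ i $ j = 0"
    using PQF_diagonalize[OF assms] by auto
  have "det P' = (\<Prod>i\<in>UNIV. P' $ i $ i)"
    using P'(4) by (intro det_diagonal) metis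
  also have "\<dots> \<le> (\<Prod>i\<in>UNIV. P $ i $ i)"
    using P'(3) PQF_diagonal_pos[OF P'(1)] by (intro prod_mono) (auto simp: less_imp_le)
  finally show ?thesis
    using P'(2) by simp
qed

section \<open>The covering radius of nearby forms from below\<close>

text \<open>The coordinate with the factor \<^term>\<open>tau\<close> now comes first, which makes the matrix \<open>T6\<close> below
  easy to factorise.\<close>

definition D6_lattice :: "(real^6) set" where
  "D6_lattice = {vector [of_int q, of_int k, of_int l, of_int m, of_int n, of_int p] | k l m n p q.
     D6_plus k l m n p q}"

definition diag_form :: "real^6^6" where
  "diag_form = (\<chi> i j. if i = j then (if i = 1 then tau else 1) else 0)"

text \<open>
  The power of \<open>v\<close> with respect to the ellipsoid of the form \<open>P\<close> that passes through the vertices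
  of a simplex of largest circumradius. It differs from \<^term>\<open>qform P\<close> by an affine function, hence
  it is expressed by the barycentric coordinates of \<open>v\<close> without knowing the centre; in particular it
  is linear in \<open>P\<close>.
\<close>

definition pw :: "real^6^6 \<Rightarrow> real^6 \<Rightarrow> real" where
  "pw P v = qform P v
     - ((v$2 - v$5) / 2 * qform P (vector [2, 2, 0, 0, 0, 0])
      + (v$3 - v$5) / 2 * qform P (vector [2, 0, 2, 0, 0, 0])
      + (v$4 - v$5) / 2 * qform P (vector [2, 0, 0, 2, 0, 0])
      + (v$5 + v$6) / 2 * qform P (vector [3, 1, 1, 1, 1, 1])
      + (v$5 - v$6) / 2 * qform P (vector [1, 1, 1, 1, 1, - 1])
      + (v$1 - v$2 - v$3 - v$4 + v$5 - v$6) / 4 * qform P (vector [4, 0, 0, 0, 0, 0]))"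

section \<open>A simplex of largest circumradius stays empty under perturbation\<close>

lemma parabola_mono_right:
  fixes x a h :: real
  assumes "h \<le> a" "a \<le> x"
  shows "a * (a - 2 * h) \<le> x * (x - 2 * h)"
proof -
  have "0 \<le> (x - a) * (x + a - 2 * h)"
    using assms by (intro mult_nonneg_nonneg) simp_all
  then show ?thesis
    by (simp add: algebra_simps)
qed

lemma parabola_mono_left:
  fixes x b h :: real
  assumes "x \<le> b" "b \<le> h"
  shows "b * (b - 2 * h) \<le> x * (x - 2 * h)"
proof -
  have "0 \<le> (b - x) * (2 * h - x - b)"
    using assms by (intro mult_nonneg_nonneg) simp_all
  then show ?thesis
    by (simp add: algebra_simps)
qed

text \<open>The power splits into one parabola per coordinate, so an entry outside a short list
  makes its summand large enough alone. The combinations left over are vertices, violate the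
  congruence modulo 4, or have power at least \<open>8 * tau\<close>. The tightest bound is
  \<open>6 * tau - 2\<close>, from \<open>n\<close> = -1 in the odd case.\<close>

lemma pw_gap:
  fixes k l m n p q :: int
  assumes D: "D6_plus k l m n p q"
    and V: "(q, k, l, m, n, p) \<notin> {(0, 0, 0, 0, 0, 0), (2, 2, 0, 0, 0, 0), (2, 0, 2, 0, 0, 0),
      (2, 0, 0, 2, 0, 0), (3, 1, 1, 1, 1, 1), (1, 1, 1, 1, 1, - 1), (4, 0, 0, 0, 0, 0)}"
  shows "1 / 2 \<le> real_of_int k * (k - 2 * (1 - tau)) + l * (l - 2 * (1 - tau))
    + m * (m - 2 * (1 - tau)) + n * (n - (3 * tau - 1)) + p\<^sup>2 + tau * (q * (q - 4))"
proof -
  define f where "f j = real_of_int j * (j - 2 * (1 - tau))" for j :: int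
  define w where "w = (3 * tau - 1) / 2"
  define g where "g = real_of_int n * (n - 2 * w)"
  define h where "h = real_of_int p * (p - 2 * 0)"
  define r where "r = tau * (real_of_int q * (real_of_int q - 2 * 2))"
  note t = tau_bounds
  have w: "2 * w = 3 * tau - 1"
    by (simp add: w_def)
  have q_ge: "tau * (real_of_int a * (real_of_int a - 4)) \<le> r"
    if "q \<le> a \<and> a \<le> 2 \<or> a \<le> q \<and> 2 \<le> a" for a
    using that parabola_mono_left[of q a 2] parabola_mono_right[of 2 a q] t
    unfolding r_def by (intro mult_left_mono) auto
  have "1 / 2 \<le> f k + f l + f m + g + h + r"
  proof (cases "even q")
    case True
    then have ev: "even k" "even l" "even m" "even n" "even p"
      using D by (auto simp: D6_plus_def)
    have f: "j = 0 \<and> f j = 0 \<or> j = 2 \<and> f j = 4 * tau \<or> 6 \<le> f j" if "even j" for j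
    proof -
      have "j = 0 \<or> j = 2 \<or> j \<le> - 2 \<or> 4 \<le> j"
        using that by presburger
      then show ?thesis
        using parabola_mono_left[of j "- 2" "1 - tau"] parabola_mono_right[of "1 - tau" 4 j] t
        unfolding f_def by auto
    qed
    have g: "n = 0 \<and> g = 0 \<or> 3 \<le> g"
    proof -
      have "n = 0 \<or> n \<le> - 2 \<or> 2 \<le> n"
        using ev by presburger
      then show ?thesis
        using parabola_mono_left[of n "- 2" w]
          parabola_mono_right[of w 2 n] t w
        unfolding g_def by auto
    qed
    have h: "p = 0 \<and> h = 0 \<or> 4 \<le> h"
    proof -
      have "p = 0 \<or> p \<le> - 2 \<or> 2 \<le> p"
        using ev by presburger
      then show ?thesis
        using parabola_mono_left[of p "- 2" 0] parabola_mono_right[of 0 2 p]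
        unfolding h_def by auto
    qed
    have r: "q = 2 \<and> r = - 4 * tau \<or> q = 0 \<and> r = 0 \<or> q = 4 \<and> r = 0 \<or> 5 \<le> r"
    proof -
      have "q = 2 \<or> q = 0 \<or> q = 4 \<or> q \<le> - 2 \<or> 6 \<le> q"
        using True by presburger
      moreover have "5 \<le> r" if "q \<le> - 2 \<or> 6 \<le> q"
        using that q_ge[of "- 2"] q_ge[of 6] t by auto
      ultimately show ?thesis
        by (auto simp: r_def)
    qed
    have sum: "4 dvd k + l + m + n + p + q"
      using D by (simp add: D6_plus_def)
    have f_nonneg: "0 \<le> f j" if "even j" for j
      using f[OF that] t by auto
    have nonneg: "0 \<le> g" "0 \<le> h" "- 4 * tau \<le> r"
      subgoal using g t by auto
      subgoal using h t by auto
      subgoal using r t by auto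
      done
    note nonneg = nonneg f_nonneg[OF ev(1)] f_nonneg[OF ev(2)] f_nonneg[OF ev(3)]
    show ?thesis
    proof (cases "6 \<le> f k \<or> 6 \<le> f l \<or> 6 \<le> f m \<or> 3 \<le> g \<or> 4 \<le> h \<or> 5 \<le> r")
      case True
      then show ?thesis
        using nonneg t by (elim disjE) linarith+
    next
      case False
      then have cases: "k = 0 \<and> f k = 0 \<or> k = 2 \<and> f k = 4 * tau"
        "l = 0 \<and> f l = 0 \<or> l = 2 \<and> f l = 4 * tau" "m = 0 \<and> f m = 0 \<or> m = 2 \<and> f m = 4 * tau"
        "n = 0" "g = 0" "p = 0" "h = 0"
        "q = 2 \<and> r = - 4 * tau \<or> q = 0 \<and> r = 0 \<or> q = 4 \<and> r = 0"
        using f[OF ev(1)] f[OF ev(2)] f[OF ev(3)] g h r by blast+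
      from cases(1,2,3,8) show ?thesis
        using sum V t unfolding cases(4-7) by (elim disjE conjE) simp_all
    qed
  next
    case False
    then have od: "odd k" "odd l" "odd m" "odd n" "odd p"
      using D by (auto simp: D6_plus_def)
    have f: "j = 1 \<and> f j = 2 * tau - 1 \<or> 2 \<le> f j" if "odd j" for j
    proof -
      have "j = 1 \<or> j \<le> - 1 \<or> 3 \<le> j"
        using that by presburger
      then show ?thesis
        using parabola_mono_left[of j "- 1" "1 - tau"] parabola_mono_right[of "1 - tau" 3 j] t
        unfolding f_def by auto
    qed
    have g: "n = 1 \<and> g = 2 - 3 * tau \<or> 3 * tau \<le> g"
    proof -
      have "n = 1 \<or> n \<le> - 1 \<or> 3 \<le> n"
        using od by presburger
      then show ?thesis
        using parabola_mono_left[of n "- 1" w]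
          parabola_mono_right[of w 3 n] t w
        unfolding g_def by auto
    qed
    have h: "p = 1 \<and> h = 1 \<or> p = - 1 \<and> h = 1 \<or> 9 \<le> h"
    proof -
      have "p = 1 \<or> p = - 1 \<or> p \<le> - 3 \<or> 3 \<le> p"
        using od by presburger
      then show ?thesis
        using parabola_mono_left[of p "- 3" 0] parabola_mono_right[of 0 3 p]
        unfolding h_def by auto
    qed
    have r: "q = 1 \<and> r = - 3 * tau \<or> q = 3 \<and> r = - 3 * tau \<or> 5 * tau \<le> r"
    proof -
      have "q = 1 \<or> q = 3 \<or> q \<le> - 1 \<or> 5 \<le> q"
        using False by presburger
      moreover have "5 * tau \<le> r" if "q \<le> - 1 \<or> 5 \<le> q"
        using that q_ge[of "- 1"] q_ge[of 5] t by auto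
      ultimately show ?thesis
        by (auto simp: r_def)
    qed
    have sum: "4 dvd k + l + m + n + p + q"
      using D by (simp add: D6_plus_def)
    have f_ge: "2 * tau - 1 \<le> f j" if "odd j" for j
      using f[OF that] t by auto
    have ge: "2 - 3 * tau \<le> g" "1 \<le> h" "- 3 * tau \<le> r"
      subgoal using g t by auto
      subgoal using h t by auto
      subgoal using r t by auto
      done
    note ge = ge f_ge[OF od(1)] f_ge[OF od(2)] f_ge[OF od(3)]
    show ?thesis
    proof (cases "2 \<le> f k \<or> 2 \<le> f l \<or> 2 \<le> f m \<or> 3 * tau \<le> g \<or> 9 \<le> h \<or> 5 * tau \<le> r")
      case True
      then show ?thesis
        using ge t by (elim disjE) linarith+
    next
      case False
      then have cases: "k = 1" "l = 1" "m = 1" "n = 1" "p = 1 \<or> p = - 1" "q = 1 \<or> q = 3"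
        using f[OF od(1)] f[OF od(2)] f[OF od(3)] g h r by blast+
      from cases(5,6) show ?thesis
        using sum V unfolding cases(1-4) by (elim disjE) simp_all
    qed
  qed
  then show ?thesis
    by (simp add: f_def g_def h_def r_def w power2_eq_square)
qed

lemma qform_diag_form: "qform diag_form v = tau * (v$1)\<^sup>2 + (v$2)\<^sup>2 + (v$3)\<^sup>2 + (v$4)\<^sup>2 + (v$5)\<^sup>2 + (v$6)\<^sup>2"
  unfolding qform_sum sum_6 diag_form_def by (simp add: power2_eq_square)

text \<open>Completing squares gives the centre (2, 1 - \<open>tau\<close>, 1 - \<open>tau\<close>,
  1 - \<open>tau\<close>, (3 \<open>tau\<close> - 1) / 2, 0). The simplex is the one behind
  \<open>pow0\<close>, moved by a lattice translation and a paired sign change.\<close>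

lemma pw_diag_form:
  "pw diag_form v = v$2 * (v$2 - 2 * (1 - tau)) + v$3 * (v$3 - 2 * (1 - tau))
    + v$4 * (v$4 - 2 * (1 - tau)) + v$5 * (v$5 - (3 * tau - 1)) + (v$6)\<^sup>2 + tau * (v$1 * (v$1 - 4))"
  unfolding pw_def qform_diag_form vector_6 power2_eq_square by (simp add: field_simps)

lemma norm_6: "(norm (v::real^6))\<^sup>2 = (v$1)\<^sup>2 + (v$2)\<^sup>2 + (v$3)\<^sup>2 + (v$4)\<^sup>2 + (v$5)\<^sup>2 + (v$6)\<^sup>2"
  unfolding norm_vec_def L2_set_def by (simp add: sum_6 add_nonneg_nonneg)

text \<open>A perturbation of the form changes the power by an amount that grows with the square of
  the norm, so a constant gap is not enough far away. The constant 6 collects 3/5 from each of four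
  coordinates and 18/5 from the weighted one.\<close>

lemma pw_diag_form_coercive: "(norm v)\<^sup>2 / 5 - 6 \<le> pw diag_form v"
proof -
  note t = tau_bounds
  have f: "x\<^sup>2 / 5 - 3 / 5 \<le> x * (x - h)" if "0 \<le> h" "h \<le> 6 / 5" for x h :: real
  proof -
    have "h * h \<le> 6 / 5 * (6 / 5)"
      using that by (intro mult_mono) simp_all
    moreover have "0 \<le> (8 * x - 5 * h)\<^sup>2"
      by simp
    ultimately show ?thesis
      by (simp add: power2_eq_square algebra_simps)
  qed
  have z: "z\<^sup>2 / 5 - 18 / 5 \<le> tau * (z * (z - 4))" for z :: real
  proof -
    have "43 * (z - 2)\<^sup>2 \<le> (100 * tau) * (z - 2)\<^sup>2"
      using t by (intro mult_right_mono) simp_all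
    moreover have "tau * (z * (z - 4)) = tau * (z - 2)\<^sup>2 - 4 * tau"
      by (simp add: power2_eq_square algebra_simps)
    moreover have "0 \<le> (23 * z - 86)\<^sup>2"
      by simp
    ultimately show ?thesis
      using t by (simp add: power2_eq_square algebra_simps)
  qed
  have e6: "(v$6)\<^sup>2 / 5 \<le> (v$6)\<^sup>2"
    by simp
  have u: "0 \<le> 2 * (1 - tau)" "2 * (1 - tau) \<le> 6 / 5" "0 \<le> 3 * tau - 1" "3 * tau - 1 \<le> 6 / 5"
    using t by simp_all
  show ?thesis
    using f[OF u(1,2), of "v$2"] f[OF u(1,2), of "v$3"] f[OF u(1,2), of "v$4"] f[OF u(3,4), of "v$5"] e6 z[of "v$1"] t
    unfolding pw_diag_form norm_6 add_divide_distrib by linarith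
qed

lemma qform_add_matrix: "qform (P + E) v = qform P v + qform E v"
  by (simp add: qform_def matrix_vector_mult_add_rdistrib inner_add_right)

lemma pw_add: "pw (P + E) v = pw P v + pw E v"
  unfolding pw_def qform_add_matrix by (simp add: distrib_left)

lemma abs_qform_le:
  fixes E :: "real^6^6"
  assumes "\<And>i j. \<bar>E $ i $ j\<bar> \<le> \<delta>"
  shows "\<bar>qform E v\<bar> \<le> 36 * \<delta> * (norm v)\<^sup>2"
proof -
  have "\<bar>v $ i * E $ i $ j * v $ j\<bar> \<le> \<delta> * (norm v)\<^sup>2" for i j
  proof -
    have "\<bar>v $ i * E $ i $ j * v $ j\<bar> = \<bar>E $ i $ j\<bar> * (\<bar>v $ i\<bar> * \<bar>v $ j\<bar>)"
      by (simp add: abs_mult)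
    also have "\<dots> \<le> \<delta> * (norm v * norm v)"
      using assms[of i j] order_trans[OF abs_ge_zero assms]
      by (intro mult_mono component_le_norm_cart) simp_all
    finally show ?thesis
      by (simp add: power2_eq_square)
  qed
  then have "\<bar>qform E v\<bar> \<le> (\<Sum>i\<in>(UNIV::6 set). \<Sum>j\<in>(UNIV::6 set). \<delta> * (norm v)\<^sup>2)"
    unfolding qform_sum by (intro order_trans[OF sum_abs] sum_mono)
  then show ?thesis
    by simp
qed

lemma abs_diff_sum6_le:
  fixes q K :: real
  assumes "\<bar>a\<bar> \<le> K" "\<bar>b\<bar> \<le> K" "\<bar>c\<bar> \<le> K" "\<bar>d\<bar> \<le> K" "\<bar>e\<bar> \<le> K" "\<bar>f\<bar> \<le> K"
  shows "\<bar>q - (a + b + c + d + e + f)\<bar> \<le> \<bar>q\<bar> + 6 * K"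
  using assms[THEN abs_le_D1] assms[THEN abs_le_D2] abs_ge_self[of q] abs_ge_minus_self[of q]
  by - (rule abs_leI; linarith)

lemma abs_pw_le:
  assumes E: "\<And>i j. \<bar>E $ i $ j\<bar> \<le> \<delta>"
  shows "\<bar>pw E v\<bar> \<le> 4000 * \<delta> * (1 + (norm v)\<^sup>2)"
proof -
  define r where "r = norm v"
  have r: "\<bar>v $ i\<bar> \<le> r" for i
    unfolding r_def by (rule component_le_norm_cart)
  have "0 \<le> \<delta>"
    using order_trans[OF abs_ge_zero E] .
  have "0 \<le> r"
    by (simp add: r_def)
  \<comment> \<open>Vertices have squared norm at most 16, and 576 = 36 * 16. The factor 3/2 comes
    from the coefficient that adds six entries and divides by 4.\<close>
  have bound: "\<bar>a * qform E x\<bar> \<le> 3 / 2 * r * (576 * \<delta>)"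
    if "\<bar>a\<bar> \<le> 3 / 2 * r" "(norm x)\<^sup>2 \<le> 16" for a x
  proof -
    have "\<bar>qform E x\<bar> \<le> 36 * \<delta> * 16"
      using abs_qform_le[OF E, of x] mult_left_mono[OF that(2), of "36 * \<delta>"] \<open>0 \<le> \<delta>\<close> by simp
    then have "\<bar>a\<bar> * \<bar>qform E x\<bar> \<le> 3 / 2 * r * (576 * \<delta>)"
      using that(1) \<open>0 \<le> r\<close> by (intro mult_mono) simp_all
    then show ?thesis
      by (simp add: abs_mult)
  qed
  have u: "v $ i \<le> r" and l: "- r \<le> v $ i" for i
    using r[of i] by (simp_all add: abs_le_iff)
  have coeffs: "\<bar>(v$2 - v$5) / 2\<bar> \<le> 3 / 2 * r" "\<bar>(v$3 - v$5) / 2\<bar> \<le> 3 / 2 * r"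
    "\<bar>(v$4 - v$5) / 2\<bar> \<le> 3 / 2 * r" "\<bar>(v$5 + v$6) / 2\<bar> \<le> 3 / 2 * r"
    "\<bar>(v$5 - v$6) / 2\<bar> \<le> 3 / 2 * r" "\<bar>(v$1 - v$2 - v$3 - v$4 + v$5 - v$6) / 4\<bar> \<le> 3 / 2 * r"
    using u[of 1] u[of 2] u[of 3] u[of 4] u[of 5] u[of 6] l[of 1] l[of 2] l[of 3] l[of 4] l[of 5] l[of 6]
    unfolding add_divide_distrib diff_divide_distrib by - (rule abs_leI; linarith)+
  note b = coeffs[THEN bound]
  have "\<bar>pw E v\<bar> \<le> \<bar>qform E v\<bar> + 6 * (3 / 2 * r * (576 * \<delta>))"
    unfolding pw_def by (rule abs_diff_sum6_le; rule b) (simp_all add: norm_6 vector_6)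
  also have "\<bar>qform E v\<bar> \<le> 36 * \<delta> * r\<^sup>2"
    using abs_qform_le[OF E] unfolding r_def .
  also have "6 * (3 / 2 * r * (576 * \<delta>)) \<le> 2592 * \<delta> * (1 + r\<^sup>2)"
  proof -
    have "2 * r \<le> 1 + r\<^sup>2"
      using zero_le_power2[of "r - 1"] by (simp add: power2_eq_square algebra_simps)
    then have "2592 * \<delta> * (2 * r) \<le> 2592 * \<delta> * (1 + r\<^sup>2)"
      using \<open>0 \<le> \<delta>\<close> by (intro mult_left_mono) simp_all
    then show ?thesis
      by (simp add: algebra_simps)
  qed
  also have "36 * \<delta> * r\<^sup>2 + 2592 * \<delta> * (1 + r\<^sup>2) \<le> 4000 * \<delta> * (1 + r\<^sup>2)"
  proof -
    have "0 \<le> 1372 * (\<delta> * r\<^sup>2) + 1408 * \<delta>"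
      using \<open>0 \<le> \<delta>\<close> by simp
    then show ?thesis
      by (simp add: algebra_simps)
  qed
  finally show ?thesis
    by (simp add: r_def)
qed

lemma pw_vertices:
  "pw P (vector [0, 0, 0, 0, 0, 0]) = 0" "pw P (vector [2, 2, 0, 0, 0, 0]) = 0"
  "pw P (vector [2, 0, 2, 0, 0, 0]) = 0" "pw P (vector [2, 0, 0, 2, 0, 0]) = 0"
  "pw P (vector [3, 1, 1, 1, 1, 1]) = 0" "pw P (vector [1, 1, 1, 1, 1, - 1]) = 0"
  "pw P (vector [4, 0, 0, 0, 0, 0]) = 0"
proof -
  have "qform P (vector [0, 0, 0, 0, 0, 0]) = 0"
    by (simp add: qform_sum sum_6 vector_6)
  then show "pw P (vector [0, 0, 0, 0, 0, 0]) = 0"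
    by (simp add: pw_def vector_6)
qed (simp_all add: pw_def vector_6)

lemma pw_nonneg_near:
  assumes P: "\<And>i j. \<bar>P $ i $ j - diag_form $ i $ j\<bar> \<le> 1 / 10 ^ 6" and v: "v \<in> D6_lattice"
  shows "0 \<le> pw P v"
proof -
  obtain k l m n p q where D: "D6_plus k l m n p q"
    and v_eq: "v = vector [of_int q, of_int k, of_int l, of_int m, of_int n, of_int p]"
    using v by (auto simp: D6_lattice_def)
  show ?thesis
  proof (cases "(q, k, l, m, n, p) \<in> {(0, 0, 0, 0, 0, 0), (2, 2, 0, 0, 0, 0), (2, 0, 2, 0, 0, 0),
      (2, 0, 0, 2, 0, 0), (3, 1, 1, 1, 1, 1), (1, 1, 1, 1, 1, - 1), (4, 0, 0, 0, 0, 0)}")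
    case True
    then show ?thesis
      unfolding v_eq by (auto simp: pw_vertices)
  next
    case False
    have "1 / 2 \<le> pw diag_form v"
      using pw_gap[OF D False] unfolding pw_diag_form v_eq vector_6 by simp
    moreover have "(norm v)\<^sup>2 / 5 - 6 \<le> pw diag_form v"
      by (rule pw_diag_form_coercive)
    \<comment> \<open>The two bounds give \<open>1 + (norm v)\<^sup>2\<close> at most five times the
      power plus 31, hence at most 67 times the power. The value 130 leaves room and still beats the
      250 that results from 4000 / 10^6.\<close>
    ultimately have "(1 + (norm v)\<^sup>2) / 130 \<le> pw diag_form v"
      by simp
    moreover have "\<bar>pw (P - diag_form) v\<bar> \<le> 4000 * (1 / 10 ^ 6) * (1 + (norm v)\<^sup>2)"
      by (rule abs_pw_le) (use P in simp)
    then have "\<bar>pw (P - diag_form) v\<bar> \<le> (1 + (norm v)\<^sup>2) / 250"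
      by simp
    moreover have "(1 + (norm v)\<^sup>2) / 250 \<le> (1 + (norm v)\<^sup>2) / 130"
      by (intro divide_left_mono) (simp_all add: add_pos_nonneg)
    moreover have "pw P v = pw diag_form v + pw (P - diag_form) v"
      using pw_add[of diag_form "P - diag_form" v] by simp
    ultimately show ?thesis
      by linarith
  qed
qed

text \<open>The witness is the circumcentre of the simplex with respect to \<open>P\<close>.\<close>

lemma hole_near:
  fixes P :: "real^6^6"
  assumes P: "P \<in> PQF" and near: "\<And>i j. \<bar>P $ i $ j - diag_form $ i $ j\<bar> \<le> 1 / 10 ^ 6"
  shows "\<exists>y. \<forall>v\<in>D6_lattice. - pw P c \<le> qform P (y - v)"
proof -
  \<comment> \<open>\<open>f\<close> is the linear function that agrees with \<open>qform P\<close>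
    at the vertices. Its gradient determines the circumcentre, by solving a linear system with
    matrix \<open>P\<close>.\<close>
  define f where "f v = qform P v - pw P v" for v
  have "\<exists>w. \<forall>v. f v = 2 * (v \<bullet> w)"
  proof -
    define g1 :: "real^6" where "g1 = vector [1 / 4, - 1 / 4, - 1 / 4, - 1 / 4, 1 / 4, - 1 / 4]"
    define g2 :: "real^6" where "g2 = vector [0, 1 / 2, 0, 0, - 1 / 2, 0]"
    define g3 :: "real^6" where "g3 = vector [0, 0, 1 / 2, 0, - 1 / 2, 0]"
    define g4 :: "real^6" where "g4 = vector [0, 0, 0, 1 / 2, - 1 / 2, 0]"
    define g5 :: "real^6" where "g5 = vector [0, 0, 0, 0, 1 / 2, 1 / 2]"
    define g6 :: "real^6" where "g6 = vector [0, 0, 0, 0, 1 / 2, - 1 / 2]"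
    note g_defs = g1_def g2_def g3_def g4_def g5_def g6_def
    have g: "(v$2 - v$5) / 2 = v \<bullet> g2" "(v$3 - v$5) / 2 = v \<bullet> g3" "(v$4 - v$5) / 2 = v \<bullet> g4"
      "(v$5 + v$6) / 2 = v \<bullet> g5" "(v$5 - v$6) / 2 = v \<bullet> g6"
      "(v$1 - v$2 - v$3 - v$4 + v$5 - v$6) / 4 = v \<bullet> g1" for v :: "real^6"
      unfolding inner_vec_def sum_6 g_defs vector_6 by simp_all
    define h where "h x = qform P x / 2" for x
    define w where "w = h (vector [2, 2, 0, 0, 0, 0]) *\<^sub>R g2 + h (vector [2, 0, 2, 0, 0, 0]) *\<^sub>R g3
      + h (vector [2, 0, 0, 2, 0, 0]) *\<^sub>R g4 + h (vector [3, 1, 1, 1, 1, 1]) *\<^sub>R g5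
      + h (vector [1, 1, 1, 1, 1, - 1]) *\<^sub>R g6 + h (vector [4, 0, 0, 0, 0, 0]) *\<^sub>R g1"
    have "f v = 2 * (v \<bullet> w)" for v
      unfolding f_def pw_def g w_def inner_add_right inner_scaleR_right by (simp add: h_def)
    then show ?thesis
      by blast
  qed
  then obtain w where w: "f v = 2 * (v \<bullet> w)" for v
    by blast
  have "inj ((*v) P)"
  proof (rule linear_injective_0[THEN iffD2, rule_format])
    show "linear ((*v) P)"
      by (rule matrix_vector_mul_linear)
    show "x = 0" if "P *v x = 0" for x
      using that P by (force simp: PQF_def qform_def)
  qed
  then have "surj ((*v) P)"
    by (intro linear_injective_imp_surjective matrix_vector_mul_linear) simp_all
  then obtain y where y: "P *v y = w"
    by (metis surjD)
  have sym: "y \<bullet> (P *v v) = v \<bullet> w" for v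
  proof -
    have "transpose P = P"
      using P by (simp add: PQF_def)
    then have "y v* P = w"
      using vector_transpose_matrix[of y P] y by simp
    then show ?thesis
      using dot_lmul_matrix[of y P v] by (simp add: inner_commute)
  qed
  have expand: "qform P (y - v) = qform P y - f v + qform P v" for v
    unfolding w by (simp add: qform_def matrix_vector_mult_diff_distrib inner_diff_left inner_diff_right sym y)
  \<comment> \<open>\<open>qform P y\<close> is the squared circumradius for \<open>P\<close>. The
    slack is \<open>qform P (y - c)\<close>, so the estimate is exact when \<open>c\<close> is the
    circumcentre.\<close>
  have "- pw P c \<le> qform P y"
    using expand[of c] qform_nonneg[OF P, of "y - c"] by (simp add: f_def)
  moreover have "qform P y \<le> qform P (y - v)" if "v \<in> D6_lattice" for v
    using expand[of v] pw_nonneg_near[OF near that] by (simp add: f_def)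
  ultimately show ?thesis
    by (intro exI[of _ y]) fastforce
qed

section \<open>Averaging over sign changes and a cyclic permutation\<close>

definition signed :: "(6 \<Rightarrow> real) \<Rightarrow> real^6^6 \<Rightarrow> real^6^6" where
  "signed s P = (\<chi> i j. s i * s j * P $ i $ j)"

definition rotate5 :: "6 \<Rightarrow> 6" where
  "rotate5 i = (if i = 1 then 1 else if i = 2 then 3 else if i = 3 then 4 else if i = 4 then 5
     else if i = 5 then 6 else 2)"

definition rotated :: "real^6^6 \<Rightarrow> real^6^6" where
  "rotated P = (\<chi> i j. P $ rotate5 i $ rotate5 j)"

text \<open>Both conditions are invariant under the automorphisms used below, because
  \<open>diag_form\<close> and the lattice are. A linear bound valid on the whole set can therefore
  be averaged with its transforms.\<close>

definition covers_near :: "real \<Rightarrow> (real^6^6) set" where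
  "covers_near m = {P \<in> PQF. (\<forall>i j. \<bar>P $ i $ j - diag_form $ i $ j\<bar> \<le> 1 / 10 ^ 6) \<and>
     (\<forall>y. \<exists>v\<in>D6_lattice. qform P (y - v) \<le> m)}"

definition flip :: "6 \<Rightarrow> 6 \<Rightarrow> 6 \<Rightarrow> real" where
  "flip a b i = (if i = a \<or> i = b then - 1 else 1)"

lemma D6_plus_rotate: "D6_plus k l m n p q \<Longrightarrow> D6_plus l m n p k q"
  by (simp add: D6_plus_def ac_simps)

lemma D6_latticeI:
  assumes "D6_plus k l m n p q"
    and "v = vector [of_int q, of_int k, of_int l, of_int m, of_int n, of_int p]"
  shows "v \<in> D6_lattice"
  using assms unfolding D6_lattice_def by blast

lemma D6_lattice_rotate: "v \<in> D6_lattice \<Longrightarrow> (\<chi> i. v $ rotate5 i) \<in> D6_lattice"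
  unfolding D6_lattice_def
  by (clarsimp simp: vec_eq_iff forall_6 vector_6 rotate5_def) (metis D6_plus_rotate)

lemma D6_lattice_flip:
  assumes "v \<in> D6_lattice" and ab: "(a, b) \<in> {(2, 3), (3, 4), (4, 5), (5, 6)}"
  shows "(\<chi> i. flip a b i * v $ i) \<in> D6_lattice"
proof -
  obtain k l m n p q where D: "D6_plus k l m n p q"
    and v: "v = vector [of_int q, of_int k, of_int l, of_int m, of_int n, of_int p]"
    using assms(1) by (auto simp: D6_lattice_def)
  \<comment> \<open>The remaining sign changes are conjugates of the known one by powers of the
    five-cycle.\<close>
  note rot = D6_plus_rotate
  have D1: "D6_plus (- k) (- l) m n p q"
    using rot[OF rot[OF rot[OF D6_plus_flip45[OF rot[OF rot[OF D]]]]]] .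
  have D2: "D6_plus k (- l) (- m) n p q"
    using rot[OF rot[OF D6_plus_flip45[OF rot[OF rot[OF rot[OF D]]]]]] .
  have D3: "D6_plus k l (- m) (- n) p q"
    using rot[OF D6_plus_flip45[OF rot[OF rot[OF rot[OF rot[OF D]]]]]] .
  have e: "(\<chi> i. flip 2 3 i * v $ i) = vector [of_int q, of_int (- k), of_int (- l), of_int m, of_int n, of_int p]"
    "(\<chi> i. flip 3 4 i * v $ i) = vector [of_int q, of_int k, of_int (- l), of_int (- m), of_int n, of_int p]"
    "(\<chi> i. flip 4 5 i * v $ i) = vector [of_int q, of_int k, of_int l, of_int (- m), of_int (- n), of_int p]"
    "(\<chi> i. flip 5 6 i * v $ i) = vector [of_int q, of_int k, of_int l, of_int m, of_int (- n), of_int (- p)]"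
    by (simp_all add: vec_eq_iff forall_6 vector_6 flip_def v)
  show ?thesis
    using ab D6_latticeI[OF D1 e(1)] D6_latticeI[OF D2 e(2)] D6_latticeI[OF D3 e(3)]
      D6_latticeI[OF D6_plus_flip45[OF D] e(4)] by auto
qed

lemma qform_signed: "qform (signed s P) x = qform P (\<chi> i. s i * x $ i)"
  unfolding qform_sum signed_def by (simp add: ac_simps)

lemma bij_rotate5: "bij rotate5"
  by (rule bij_betw_byWitness[of _ "\<lambda>i. if i = 1 then 1 else if i = 2 then 6 else if i = 3 then 2
     else if i = 4 then 3 else if i = 5 then 4 else 5"]) (auto simp: rotate5_def forall_6)

lemma qform_rotated: "qform (rotated P) (\<chi> i. x $ rotate5 i) = qform P x"
proof -
  have sum: "(\<Sum>i\<in>UNIV. f (rotate5 i)) = sum f UNIV" for f :: "6 \<Rightarrow> real"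
    using bij_rotate5 by (rule sum.reindex_bij_betw)
  show ?thesis
    unfolding qform_sum rotated_def
    by (simp add: sum[of "\<lambda>j. x $ rotate5 i * P $ rotate5 i $ j * x $ j" for i]
        sum[of "\<lambda>i. \<Sum>j\<in>UNIV. x $ i * P $ i $ j * x $ j"])
qed

lemma signed_covers_near:
  assumes P: "P \<in> covers_near m" and ab: "(a, b) \<in> {(2, 3), (3, 4), (4, 5), (5, 6)}"
  shows "signed (flip a b) P \<in> covers_near m"
proof -
  define s where "s = flip a b"
  have ss: "s i * s i = 1" for i
    by (simp add: s_def flip_def)
  have s1: "\<bar>s i\<bar> = 1" for i
    by (simp add: s_def flip_def)
  define g :: "real^6 \<Rightarrow> real^6" where "g x = (\<chi> i. s i * x $ i)" for x
  have g: "g (g x) = x" for x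
    by (simp add: g_def vec_eq_iff ss flip: mult.assoc)
  have qf: "qform (signed s P) x = qform P (g x)" for x
    by (simp add: qform_signed g_def)
  have PQF: "P \<in> PQF" and near: "\<And>i j. \<bar>P $ i $ j - diag_form $ i $ j\<bar> \<le> 1 / 10 ^ 6"
    and cov: "\<And>y. \<exists>v\<in>D6_lattice. qform P (y - v) \<le> m"
    using P by (auto simp: covers_near_def)
  have "g 0 = 0"
    by (simp add: g_def vec_eq_iff)
  then have "g x = 0 \<Longrightarrow> x = 0" for x
    using g[of x] by simp
  then have "0 < qform (signed s P) x" if "x \<noteq> 0" for x
    using that PQF unfolding qf PQF_def by blast
  then have "signed s P \<in> PQF"
    using PQF unfolding PQF_def by (auto simp: transpose_def signed_def vec_eq_iff)
  moreover have "\<bar>signed s P $ i $ j - diag_form $ i $ j\<bar> \<le> 1 / 10 ^ 6" for i j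
  proof -
    have "signed s P $ i $ j - diag_form $ i $ j = s i * s j * (P $ i $ j - diag_form $ i $ j)"
      by (auto simp: signed_def diag_form_def algebra_simps ss)
    then show ?thesis
      using near[of i j] by (simp add: abs_mult s1)
  qed
  moreover have "\<exists>v\<in>D6_lattice. qform (signed s P) (y - v) \<le> m" for y
  proof -
    obtain v where v: "v \<in> D6_lattice" "qform P (g y - v) \<le> m"
      using cov by blast
    have "g v \<in> D6_lattice"
      using D6_lattice_flip[OF v(1) ab] by (simp add: g_def s_def)
    moreover have "g (y - g v) = g y - g (g v)"
      by (simp add: g_def vec_eq_iff algebra_simps)
    ultimately show ?thesis
      using v(2) by (intro bexI[of _ "g v"]) (simp_all add: qf g)
  qed
  ultimately show ?thesis
    by (simp add: covers_near_def s_def)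
qed

lemma rotated_covers_near:
  assumes P: "P \<in> covers_near m"
  shows "rotated P \<in> covers_near m"
proof -
  define g :: "real^6 \<Rightarrow> real^6" where "g x = (\<chi> i. x $ rotate5 i)" for x
  have qf: "qform (rotated P) (g x) = qform P x" for x
    by (simp add: qform_rotated g_def)
  have surj: "\<exists>y. x = g y" for x
  proof -
    have "g (\<chi> i. x $ inv rotate5 i) = x"
      using bij_rotate5 by (simp add: g_def vec_eq_iff bij_is_inj)
    then show ?thesis
      by metis
  qed
  have PQF: "P \<in> PQF" and near: "\<And>i j. \<bar>P $ i $ j - diag_form $ i $ j\<bar> \<le> 1 / 10 ^ 6"
    and cov: "\<And>y. \<exists>v\<in>D6_lattice. qform P (y - v) \<le> m"
    using P by (auto simp: covers_near_def)
  have "0 < qform (rotated P) x" if "x \<noteq> 0" for x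
  proof -
    obtain y where y: "x = g y"
      using surj by blast
    have "y \<noteq> 0"
      using that by (auto simp: y g_def vec_eq_iff)
    then show ?thesis
      using PQF by (simp add: y qf PQF_def)
  qed
  then have "rotated P \<in> PQF"
    using PQF unfolding PQF_def by (auto simp: transpose_def rotated_def vec_eq_iff)
  moreover have "\<bar>rotated P $ i $ j - diag_form $ i $ j\<bar> \<le> 1 / 10 ^ 6" for i j
  proof -
    have "diag_form $ i $ j = diag_form $ rotate5 i $ rotate5 j"
      using bij_rotate5 by (auto simp: diag_form_def bij_is_inj inj_eq) (auto simp: rotate5_def split: if_splits)
    then show ?thesis
      using near[of "rotate5 i" "rotate5 j"] by (simp add: rotated_def)
  qed
  moreover have "\<exists>v\<in>D6_lattice. qform (rotated P) (y - v) \<le> m" for y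
  proof -
    obtain z where z: "y = g z"
      using surj by blast
    obtain v where v: "v \<in> D6_lattice" "qform P (z - v) \<le> m"
      using cov by blast
    have "g v \<in> D6_lattice"
      using D6_lattice_rotate[OF v(1)] by (simp add: g_def)
    moreover have "g z - g v = g (z - v)"
      by (simp add: g_def vec_eq_iff)
    ultimately show ?thesis
      using v(2) by (intro bexI[of _ "g v"]) (simp_all add: qf z)
  qed
  ultimately show ?thesis
    by (simp add: covers_near_def)
qed

text \<open>
  Averaging a linear bound over an automorphism kills the coefficients that the automorphism
  changes the sign of. The sign changes of neighbouring coordinates leave only the diagonal.
\<close>

lemma flip_average:
  assumes le: "\<forall>P\<in>covers_near m. (\<Sum>i\<in>UNIV. \<Sum>j\<in>UNIV. M i j * P $ i $ j) \<le> m"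
    and ab: "(a, b) \<in> {(2, 3), (3, 4), (4, 5), (5, 6)}"
  shows "\<forall>P\<in>covers_near m.
    (\<Sum>i\<in>UNIV. \<Sum>j\<in>UNIV. (if flip a b i = flip a b j then M i j else 0) * P $ i $ j) \<le> m"
proof
  fix P
  assume P: "P \<in> covers_near m"
  have "2 * ((if flip a b i = flip a b j then M i j else 0) * P $ i $ j)
      = M i j * P $ i $ j + M i j * signed (flip a b) P $ i $ j" for i j
    by (simp add: signed_def flip_def)
  then have "2 * (\<Sum>i\<in>UNIV. \<Sum>j\<in>UNIV. (if flip a b i = flip a b j then M i j else 0) * P $ i $ j)
      = (\<Sum>i\<in>UNIV. \<Sum>j\<in>UNIV. M i j * P $ i $ j) + (\<Sum>i\<in>UNIV. \<Sum>j\<in>UNIV. M i j * signed (flip a b) P $ i $ j)"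
    by (simp add: sum_distrib_left sum.distrib)
  then show "(\<Sum>i\<in>UNIV. \<Sum>j\<in>UNIV. (if flip a b i = flip a b j then M i j else 0) * P $ i $ j) \<le> m"
    using bspec[OF le P] bspec[OF le signed_covers_near[OF P ab]] by simp
qed

lemma diagonal_average:
  assumes le: "\<forall>P\<in>covers_near m. (\<Sum>i\<in>UNIV. \<Sum>j\<in>UNIV. M i j * P $ i $ j) \<le> m"
    and P: "P \<in> covers_near m"
  shows "(\<Sum>i\<in>UNIV. M i i * P $ i $ i) \<le> m"
proof -
  note avg1 = flip_average[OF le, of 2 3]
  note avg2 = flip_average[OF avg1, of 3 4]
  note avg3 = flip_average[OF avg2, of 4 5]
  note avg4 = flip_average[OF avg3, of 5 6, THEN bspec, OF _ _ _ _ P]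
  \<comment> \<open>The four sign vectors give each of the six indices a different pattern of signs,
    so they all agree at \<open>i\<close> and \<open>j\<close> only if \<open>i = j\<close>.\<close>
  have "(if flip 5 6 i = flip 5 6 j then if flip 4 5 i = flip 4 5 j then if flip 3 4 i = flip 3 4 j
      then if flip 2 3 i = flip 2 3 j then M i j else 0 else 0 else 0 else 0)
      = (if i = j then M i i else 0)" for i j
    using exhaust_6[of i] exhaust_6[of j] by (elim disjE) (simp_all add: flip_def)
  with avg4 have "(\<Sum>i\<in>UNIV. \<Sum>j\<in>UNIV. (if i = j then M i i else 0) * P $ i $ j) \<le> m"
    by simp
  moreover have "(\<Sum>j\<in>UNIV. (if i = j then M i i else 0) * P $ i $ j) = M i i * P $ i $ i" for i
    by (simp add: if_distrib[of "\<lambda>x. x * _"] cong: if_cong)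
  ultimately show ?thesis
    by simp
qed

text \<open>\<open>M\<close> is the second moment matrix of the vertices, weighted by the
  barycentric coordinates of \<open>c\<close>, minus the rank one matrix of \<open>c\<close>: a
  covariance matrix. Its diagonal is all that survives the averaging.\<close>

lemma pw_moments:
  fixes c :: "real^6"
  shows "\<exists>M. (\<forall>P. - pw P c = (\<Sum>i\<in>UNIV. \<Sum>j\<in>UNIV. M i j * P $ i $ j)) \<and>
    M 1 1 = (c$2 + c$3 + c$4 - 3 * c$5) * 2 + (c$5 + c$6) / 2 * 9 + (c$5 - c$6) / 2
      + (c$1 - c$2 - c$3 - c$4 + c$5 - c$6) * 4 - (c$1)\<^sup>2 \<and>
    M 2 2 = (c$2 - c$5) * 2 + c$5 - (c$2)\<^sup>2 \<and> M 3 3 = (c$3 - c$5) * 2 + c$5 - (c$3)\<^sup>2 \<and>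
    M 4 4 = (c$4 - c$5) * 2 + c$5 - (c$4)\<^sup>2 \<and> M 5 5 = c$5 - (c$5)\<^sup>2 \<and> M 6 6 = c$5 - (c$6)\<^sup>2"
proof -
  define t where "t a x i j = a * (x $ i * x $ j)" for a :: real and x :: "real^6" and i j
  define M where "M i j = t ((c$2 - c$5) / 2) (vector [2, 2, 0, 0, 0, 0]) i j
      + t ((c$3 - c$5) / 2) (vector [2, 0, 2, 0, 0, 0]) i j
      + t ((c$4 - c$5) / 2) (vector [2, 0, 0, 2, 0, 0]) i j
      + t ((c$5 + c$6) / 2) (vector [3, 1, 1, 1, 1, 1]) i j
      + t ((c$5 - c$6) / 2) (vector [1, 1, 1, 1, 1, - 1]) i j
      + t ((c$1 - c$2 - c$3 - c$4 + c$5 - c$6) / 4) (vector [4, 0, 0, 0, 0, 0]) i j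
      - t 1 c i j" for i j
  have t: "(\<Sum>i\<in>UNIV. \<Sum>j\<in>UNIV. t a x i j * P $ i $ j) = a * qform P x" for a x P
    unfolding t_def qform_sum by (simp add: sum_distrib_left ac_simps)
  have "- pw P c = (\<Sum>i\<in>UNIV. \<Sum>j\<in>UNIV. M i j * P $ i $ j)" for P
    unfolding M_def distrib_right left_diff_distrib sum.distrib sum_subtractf t pw_def by simp
  then show ?thesis
    by (intro exI[of _ M]) (simp add: M_def t_def vector_6 power2_eq_square add_divide_distrib diff_divide_distrib)
qed

lemma rotated_nth: "rotated P $ i $ j = P $ rotate5 i $ rotate5 j"
  by (simp add: rotated_def)

lemma rotate5_simps:
  "rotate5 1 = 1" "rotate5 2 = 3" "rotate5 3 = 4" "rotate5 4 = 5" "rotate5 5 = 6" "rotate5 6 = 2"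
  by (simp_all add: rotate5_def)

text \<open>Summed over the five rotations, every variable meets every weight exactly once, so only
  the sum of the weights remains.\<close>

lemma cyclic_sum_le:
  fixes a m :: real
  assumes "a + m2 * x2 + m3 * x3 + m4 * x4 + m5 * x5 + m6 * x6 \<le> m"
    "a + m2 * x3 + m3 * x4 + m4 * x5 + m5 * x6 + m6 * x2 \<le> m"
    "a + m2 * x4 + m3 * x5 + m4 * x6 + m5 * x2 + m6 * x3 \<le> m"
    "a + m2 * x5 + m3 * x6 + m4 * x2 + m5 * x3 + m6 * x4 \<le> m"
    "a + m2 * x6 + m3 * x2 + m4 * x3 + m5 * x4 + m6 * x5 \<le> m"
  shows "5 * a + (m2 + m3 + m4 + m5 + m6) * (x2 + x3 + x4 + x5 + x6) \<le> 5 * m"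
proof -
  have "5 * a + (m2 + m3 + m4 + m5 + m6) * (x2 + x3 + x4 + x5 + x6)
      = (a + m2 * x2 + m3 * x3 + m4 * x4 + m5 * x5 + m6 * x6)
      + (a + m2 * x3 + m3 * x4 + m4 * x5 + m5 * x6 + m6 * x2)
      + (a + m2 * x4 + m3 * x5 + m4 * x6 + m5 * x2 + m6 * x3)
      + (a + m2 * x5 + m3 * x6 + m4 * x2 + m5 * x3 + m6 * x4)
      + (a + m2 * x6 + m3 * x2 + m4 * x3 + m5 * x4 + m6 * x5)"
    by algebra
  also have "\<dots> \<le> m + m + m + m + m"
    by (intro add_mono[OF add_mono[OF add_mono[OF add_mono]]] assms)
  finally show ?thesis
    by simp
qed

lemma covers_near_ge:
  assumes P: "P \<in> covers_near m"
  shows "rad / 6 * (P $ 1 $ 1 / tau + P $ 2 $ 2 + P $ 3 $ 3 + P $ 4 $ 4 + P $ 5 $ 5 + P $ 6 $ 6) \<le> m"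
proof -
  define c :: "real^6" where "c = vector [2, 1 - tau, 1 - tau, 1 - tau, (3 * tau - 1) / 2, 0]"
  obtain M where M: "\<And>P. - pw P c = (\<Sum>i\<in>UNIV. \<Sum>j\<in>UNIV. M i j * P $ i $ j)"
    and M1: "M 1 1 = (c$2 + c$3 + c$4 - 3 * c$5) * 2 + (c$5 + c$6) / 2 * 9 + (c$5 - c$6) / 2
      + (c$1 - c$2 - c$3 - c$4 + c$5 - c$6) * 4 - (c$1)\<^sup>2"
    and Ms: "M 2 2 = (c$2 - c$5) * 2 + c$5 - (c$2)\<^sup>2" "M 3 3 = (c$3 - c$5) * 2 + c$5 - (c$3)\<^sup>2"
      "M 4 4 = (c$4 - c$5) * 2 + c$5 - (c$4)\<^sup>2" "M 5 5 = c$5 - (c$5)\<^sup>2" "M 6 6 = c$5 - (c$6)\<^sup>2"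
    using pw_moments[of c] by blast
  have sq: "tau * tau = (70 * tau + 13) / 231"
    using tau_square by (simp add: power2_eq_square)
  have "tau > 0"
    using tau_bounds by simp
  \<comment> \<open>At this centre \<open>M 1 1\<close> is (21 tau - 7) / 2, and the other five
    diagonal entries add up to (13 - 21 tau^2) / 4. Proportionality to the inverse of
    \<open>diag_form\<close> asks that \<open>tau\<close> times the former be a fifth of the latter,
    which is the equation 231 tau^2 = 70 tau + 13.\<close>
  have M1': "M 1 1 = rad / (6 * tau)"
    using sq \<open>tau > 0\<close> unfolding M1 c_def vector_6 rad_def by (simp add: field_simps)
  have M5: "M 2 2 + M 3 3 + M 4 4 + M 5 5 + M 6 6 = 5 * (rad / 6)"
    using sq unfolding Ms c_def vector_6 rad_def by (simp add: power2_eq_square field_simps)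
  have le: "\<forall>P\<in>covers_near m. (\<Sum>i\<in>UNIV. \<Sum>j\<in>UNIV. M i j * P $ i $ j) \<le> m"
  proof
    fix P
    assume "P \<in> covers_near m"
    obtain y where y: "\<And>v. v \<in> D6_lattice \<Longrightarrow> - pw P c \<le> qform P (y - v)"
      using hole_near[of P c] \<open>P \<in> covers_near m\<close> by (auto simp: covers_near_def)
    moreover obtain v where "v \<in> D6_lattice" "qform P (y - v) \<le> m"
      using \<open>P \<in> covers_near m\<close> unfolding covers_near_def by blast
    ultimately show "(\<Sum>i\<in>UNIV. \<Sum>j\<in>UNIV. M i j * P $ i $ j) \<le> m"
      unfolding M[symmetric] by force
  qed
  note diag = diagonal_average[OF le, unfolded sum_6]
  note R1 = rotated_covers_near[OF P]
  note R2 = rotated_covers_near[OF R1]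
  note R3 = rotated_covers_near[OF R2]
  note R4 = rotated_covers_near[OF R3]
  have "M 1 1 * P $ 1 $ 1 + rad / 6 * (P $ 2 $ 2 + P $ 3 $ 3 + P $ 4 $ 4 + P $ 5 $ 5 + P $ 6 $ 6) \<le> m"
  proof -
    have "5 * (M 1 1 * P $ 1 $ 1) + (M 2 2 + M 3 3 + M 4 4 + M 5 5 + M 6 6)
        * (P $ 2 $ 2 + P $ 3 $ 3 + P $ 4 $ 4 + P $ 5 $ 5 + P $ 6 $ 6) \<le> 5 * m"
      by (rule cyclic_sum_le[OF diag[OF P] diag[OF R1, unfolded rotated_nth rotate5_simps]
        diag[OF R2, unfolded rotated_nth rotate5_simps] diag[OF R3, unfolded rotated_nth rotate5_simps]
        diag[OF R4, unfolded rotated_nth rotate5_simps]])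
    then show ?thesis
      unfolding M5 by simp
  qed
  then show ?thesis
    unfolding M1' by (simp add: field_simps)
qed

section \<open>The form \<open>Q6c2\<close>\<close>

text \<open>The columns are a basis of the lattice \<open>D6_lattice\<close> in which
  \<open>diag_form\<close> becomes a multiple of \<open>Q6c2\<close>.\<close>

definition T6 :: "real^6^6" where
  "T6 = vector
    [vector [4, 1, 2, 2, - 1, 1],
     vector [0, 1, 0, 0, 1, 1],
     vector [0, 1, 2, 0, 1, 1],
     vector [0, 1, 0, 2, 1, 1],
     vector [0, - 1, 0, 0, 1, 1],
     vector [0, 1, 0, 0, 1, - 1]]"

lemma T6_mult: "T6 *v v = vector
  [4 * v$1 + v$2 + 2 * v$3 + 2 * v$4 - v$5 + v$6, v$2 + v$5 + v$6, v$2 + 2 * v$3 + v$5 + v$6,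
   v$2 + 2 * v$4 + v$5 + v$6, - v$2 + v$5 + v$6, v$2 + v$5 - v$6]"
  unfolding vec_eq_iff forall_6 matrix_vector_mult_def T6_def by (simp add: sum_6 vector_6)

text \<open>Up to sign this is the covolume of twice the unimodular lattice $D_6^+$. A factorisation
  into triangular matrices avoids expanding the determinant.\<close>

lemma det_T6: "det T6 = - 64"
proof -
  define L :: "real^6^6" where "L = vector
    [vector [1, 0, 0, 0, 0, 0],
     vector [0, 1, 0, 0, 0, 0],
     vector [0, 1, 1, 0, 0, 0],
     vector [0, 1, 0, 1, 0, 0],
     vector [0, - 1, 0, 0, 1, 0],
     vector [0, 1, 0, 0, 0, 1]]"
  define U :: "real^6^6" where "U = vector
    [vector [4, 1, 2, 2, - 1, 1],
     vector [0, 1, 0, 0, 1, 1],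
     vector [0, 0, 2, 0, 0, 0],
     vector [0, 0, 0, 2, 0, 0],
     vector [0, 0, 0, 0, 2, 2],
     vector [0, 0, 0, 0, 0, - 2]]"
  \<comment> \<open>The positions are spelled out because in the type \<open>6\<close> the numeral 6
    denotes 0.\<close>
  define r :: "6 \<Rightarrow> nat" where "r i = (if i = 1 then 1 else if i = 2 then 2 else if i = 3 then 3
    else if i = 4 then 4 else if i = 5 then 5 else 6)" for i
  define r' :: "6 \<Rightarrow> nat" where "r' i = 6 - r i" for i
  have all: "(\<forall>i j. P i j) \<longleftrightarrow> (\<forall>i. P i 1 \<and> P i 2 \<and> P i 3 \<and> P i 4 \<and> P i 5 \<and> P i 6)" for P :: "6 \<Rightarrow> 6 \<Rightarrow> bool"
    by (simp add: forall_6)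
  have "inj r"
    unfolding inj_def all unfolding forall_6 by (simp add: r_def)
  have "inj r'"
    unfolding inj_def all unfolding forall_6 by (simp add: r_def r'_def)
  have "\<forall>i j. r j < r i \<longrightarrow> U $ i $ j = 0"
    unfolding all unfolding forall_6 by (simp add: r_def U_def vector_6)
  then have "det U = - 64"
    using det_upper_triangular_rank[OF \<open>inj r\<close>, of U] by (simp add: prod_6 U_def vector_6)
  moreover have "\<forall>i j. r' j < r' i \<longrightarrow> L $ i $ j = 0"
    unfolding all unfolding forall_6 by (simp add: r_def r'_def L_def vector_6)
  then have "det L = 1"
    using det_upper_triangular_rank[OF \<open>inj r'\<close>, of L] by (simp add: prod_6 L_def vector_6)
  moreover have LU: "T6 = L ** U"
    unfolding vec_eq_iff all unfolding forall_6 matrix_matrix_mult_def T6_def L_def U_def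
    by (simp add: sum_6 vector_6)
  ultimately show ?thesis
    unfolding LU det_mul by simp
qed

lemma int_lattice_6:
  "v \<in> int_lattice \<longleftrightarrow> (\<exists>a b c d e f :: int. v = vector [of_int a, of_int b, of_int c, of_int d, of_int e, of_int f])"
  for v :: "real^6"
proof
  assume "v \<in> int_lattice"
  then have "\<forall>i. \<exists>n::int. v $ i = of_int n"
    by (auto simp: int_lattice_def elim: Ints_cases)
  then obtain n where n: "v $ i = of_int (n i)" for i
    by metis
  then have "v = vector [of_int (n 1), of_int (n 2), of_int (n 3), of_int (n 4), of_int (n 5), of_int (n 6)]"
    by (simp add: vec_eq_iff forall_6 vector_6)
  then show "\<exists>a b c d e f :: int. v = vector [of_int a, of_int b, of_int c, of_int d, of_int e, of_int f]"
    by blast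
qed (auto simp: int_lattice_def forall_6 vector_6)

lemma T6_int_lattice: "v \<in> int_lattice \<Longrightarrow> T6 *v v \<in> D6_lattice"
proof -
  assume "v \<in> int_lattice"
  then obtain a b c d e f :: int
    where v: "v = vector [of_int a, of_int b, of_int c, of_int d, of_int e, of_int f]"
    unfolding int_lattice_6 by blast
  have "4 dvd (b + e + f) + (b + 2 * c + e + f) + (b + 2 * d + e + f) + (- b + e + f) + (b + e - f)
      + (4 * a + b + 2 * c + 2 * d - e + f)"
  proof -
    have "(b + e + f) + (b + 2 * c + e + f) + (b + 2 * d + e + f) + (- b + e + f) + (b + e - f)
      + (4 * a + b + 2 * c + 2 * d - e + f) = 4 * (a + b + c + d + e + f)"
      by simp
    then show ?thesis
      by simp
  qed
  then have "D6_plus (b + e + f) (b + 2 * c + e + f) (b + 2 * d + e + f) (- b + e + f) (b + e - f)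
      (4 * a + b + 2 * c + 2 * d - e + f)"
    by (simp add: D6_plus_def)
  then show ?thesis
    by (rule D6_latticeI) (simp add: T6_mult v vector_6)
qed

lemma D6_lattice_T6:
  assumes "w \<in> D6_lattice"
  obtains v where "v \<in> int_lattice" "T6 *v v = w"
proof -
  obtain k l m n p q where D: "D6_plus k l m n p q"
    and w: "w = vector [of_int q, of_int k, of_int l, of_int m, of_int n, of_int p]"
    using assms by (auto simp: D6_lattice_def)
  have "even (k - n)" "even (l - k)" "even (m - k)" "even (k - p)" "even (n + p)"
    using D by (auto simp: D6_plus_def)
  then obtain b c d f e where
    n: "k - n = 2 * b" and l: "l - k = 2 * c" and m: "m - k = 2 * d" and p: "k - p = 2 * f"
    and np: "n + p = 2 * e"
    by (meson evenE)
  have "4 dvd k + l + m + n + p + q"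
    using D by (simp add: D6_plus_def)
  then obtain g where g: "k + l + m + n + p + q = 4 * g"
    by (elim dvdE)
  have "even (l + m)"
    using D by (auto simp: D6_plus_def)
  then obtain h where h: "l + m = 2 * h"
    by (elim evenE)
  \<comment> \<open>The entries of \<open>T6 *v v\<close> add up to four times the sum of the
    entries of \<open>v\<close>. Here b + c + d + e + f = h, which leaves g - h for the first
    entry.\<close>
  define v :: "real^6" where
    "v = vector [of_int (g - h), of_int b, of_int c, of_int d, of_int e, of_int f]"
  have "k = b + e + f" "l = b + 2 * c + e + f" "m = b + 2 * d + e + f" "n = - b + e + f" "p = b + e - f"
    using n l m p np by linarith+
  moreover have "q = 4 * (g - h) + b + 2 * c + 2 * d - e + f"
    using n l m p np g h by smt
  ultimately have "T6 *v v = w"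
    by (simp add: T6_mult v_def w vector_6)
  moreover have "v \<in> int_lattice"
    unfolding int_lattice_6 v_def by blast
  ultimately show ?thesis
    using that by blast
qed

definition scl :: real where
  "scl = (259 + 5 * sqrt 1057) / 352"

lemma scl: "scl = 3 / 4 + 5 / 4 * ((sqrt 1057 - 1) / 88)"
  "scl * tau = 1 / 4 + 3 / 4 * ((sqrt 1057 - 1) / 88)"
  "0 < scl"
proof -
  have "sqrt 1057 * sqrt 1057 = (1057::real)"
    by simp
  then show "scl * tau = 1 / 4 + 3 / 4 * ((sqrt 1057 - 1) / 88)"
    unfolding scl_def tau_def by (simp add: field_simps)
qed (simp_all add: scl_def field_simps add_pos_nonneg)

lemma Q6c2_eq: "Q6c2 = scl *\<^sub>R (transpose T6 ** diag_form ** T6)"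
proof -
  have "(transpose T6 ** diag_form ** T6) $ i $ j
      = (\<Sum>k\<in>UNIV. diag_form $ k $ k * (T6 $ k $ i * T6 $ k $ j))" for i j
  proof -
    have "(diag_form ** T6) $ k $ j = diag_form $ k $ k * T6 $ k $ j" for k
    proof -
      have "(\<Sum>l\<in>UNIV. diag_form $ k $ l * T6 $ l $ j) = (\<Sum>l\<in>{k}. diag_form $ k $ l * T6 $ l $ j)"
        by (rule sum.mono_neutral_right) (auto simp: diag_form_def)
      then show ?thesis
        by (simp add: matrix_matrix_mult_def)
    qed
    moreover have "(transpose T6 ** X) $ i $ j = (\<Sum>k\<in>UNIV. T6 $ k $ i * X $ k $ j)" for X :: "real^6^6"
      by (simp add: matrix_matrix_mult_def transpose_def)
    ultimately show ?thesis
      unfolding matrix_mul_assoc[symmetric] by (simp add: ac_simps)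
  qed
  then have entry: "(scl *\<^sub>R (transpose T6 ** diag_form ** T6)) $ i $ j = (scl * tau) * (T6 $ 1 $ i * T6 $ 1 $ j)
     + scl * (T6 $ 2 $ i * T6 $ 2 $ j + T6 $ 3 $ i * T6 $ 3 $ j + T6 $ 4 $ i * T6 $ 4 $ j
        + T6 $ 5 $ i * T6 $ 5 $ j + T6 $ 6 $ i * T6 $ 6 $ j)" for i j
    by (simp add: sum_6 diag_form_def algebra_simps)
  \<comment> \<open>With \<alpha> kept abstract the comparison is linear in \<alpha>: every
    \<open>Q_E6_dual\<close> + \<alpha> \<open>R1\<close> is diagonal in these coordinates, with
    entry 1/4 + 3/4 \<alpha> once and 3/4 + 5/4 \<alpha> five times. At the value used,
    \<open>tau\<close> is their quotient.\<close>
  define \<alpha> where "\<alpha> = (sqrt 1057 - 1) / 88"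
  show ?thesis
    unfolding vec_eq_iff entry scl(2) unfolding scl(1) unfolding forall_6 T6_def Q6c2_def Q_E6_dual_def
      R1_def \<alpha>_def[symmetric]
    by (simp add: vector_6 algebra_simps)
qed

lemma qform_scaleR: "qform (c *\<^sub>R P) x = c * qform P x"
  by (simp add: qform_sum sum_distrib_left ac_simps)

lemma qform_Q6c2: "qform Q6c2 x = scl * qform diag_form (T6 *v x)"
  unfolding Q6c2_eq qform_scaleR qform_congruence ..

lemma diag_form_PQF: "diag_form \<in> PQF"
proof -
  have "0 < qform diag_form x" if "x \<noteq> 0" for x
  proof -
    have "0 < (norm x)\<^sup>2"
      using that by simp
    moreover have "tau * (norm x)\<^sup>2 \<le> qform diag_form x"
    proof -
      have "tau * (y::real)\<^sup>2 \<le> y\<^sup>2" for y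
        using tau_bounds by (simp add: mult_left_le_one_le)
      then show ?thesis
        unfolding norm_6 qform_diag_form distrib_left by (intro add_mono order_refl)
    qed
    moreover have "0 < tau"
      using tau_bounds by simp
    ultimately show ?thesis
      using mult_pos_pos by (meson less_le_trans)
  qed
  moreover have "transpose diag_form = diag_form"
    by (simp add: transpose_def diag_form_def vec_eq_iff)
  ultimately show ?thesis
    by (simp add: PQF_def)
qed

lemma T6_inverse: obtains S where "S ** T6 = mat 1" "T6 ** S = mat 1"
  using det_T6 invertible_det_nz[of T6] by (auto simp: invertible_def)

lemma T6_inj: "T6 *v x = 0 \<Longrightarrow> x = 0"
  by (rule T6_inverse) (metis matrix_vector_mul_assoc matrix_vector_mul_lid matrix_vector_mult_0_right)

lemma PQF_scaleR: "P \<in> PQF \<Longrightarrow> 0 < c \<Longrightarrow> c *\<^sub>R P \<in> PQF"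
proof -
  have "transpose (c *\<^sub>R P) = c *\<^sub>R transpose P"
    by (simp add: transpose_def vec_eq_iff)
  then show "P \<in> PQF \<Longrightarrow> 0 < c \<Longrightarrow> c *\<^sub>R P \<in> PQF"
    by (simp add: PQF_def qform_scaleR)
qed

lemma Q6c2_PQF: "Q6c2 \<in> PQF"
  unfolding Q6c2_eq by (rule PQF_scaleR[OF PQF_congruence[OF diag_form_PQF T6_inj] scl(3)])

lemma det_scaleR:
  fixes A :: "real^'n^'n"
  shows "det (c *\<^sub>R A) = c ^ CARD('n) * det A"
proof -
  have "c *\<^sub>R A = (\<chi> i. c *s A $ i)"
    by (simp add: vec_eq_iff)
  then show ?thesis
    using det_rows_mul[of "\<lambda>_. c" "\<lambda>i. A $ i"] by (simp add: vec_lambda_eta)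
qed

lemma det_Q6c2: "det Q6c2 = scl ^ 6 * 4096 * tau"
proof -
  have "det diag_form = tau"
    by (subst det_diagonal) (simp_all add: diag_form_def prod_6)
  then show ?thesis
    unfolding Q6c2_eq det_scaleR det_mul det_transpose det_T6 by simp
qed

section \<open>Two-sided bounds for the covering radius and local optimality\<close>

lemma min_dist_le_mu:
  fixes Q :: "real^'n^'n"
  assumes "Q \<in> PQF"
  shows "min_dist Q x \<le> mu Q"
  using mu_attained[OF assms] by auto

lemma mu_Q6c2_le: "mu Q6c2 \<le> scl * rad"
proof -
  obtain x where x: "mu Q6c2 = min_dist Q6c2 x"
    using mu_attained[OF Q6c2_PQF] by blast
  define y where "y = T6 *v x"
  obtain k l m n p q where D: "D6_plus k l m n p q"
    and le: "nrm (y$2 - of_int k) (y$3 - of_int l) (y$4 - of_int m) (y$5 - of_int n) (y$6 - of_int p)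
      (y$1 - of_int q) \<le> rad"
    using covered_all[of "y$2" "y$3" "y$4" "y$5" "y$6" "y$1"] unfolding covered_def by blast
  define w :: "real^6" where "w = vector [of_int q, of_int k, of_int l, of_int m, of_int n, of_int p]"
  have "w \<in> D6_lattice"
    using D6_latticeI[OF D] by (simp add: w_def)
  then obtain v where v: "v \<in> int_lattice" "T6 *v v = w"
    using D6_lattice_T6 by blast
  have "mu Q6c2 \<le> qform Q6c2 (x - v)"
    unfolding x by (rule min_dist_le[OF Q6c2_PQF v(1)])
  also have "\<dots> = scl * qform diag_form (y - w)"
    by (simp add: qform_Q6c2 matrix_vector_mult_diff_distrib v(2) y_def)
  also have "\<dots> \<le> scl * rad"
    using le scl(3) by (intro mult_left_mono) (simp_all add: qform_diag_form w_def vector_6 nrm_def add_ac)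
  finally show ?thesis .
qed

lemma arith_geom_6:
  fixes x :: "6 \<Rightarrow> real"
  assumes "\<And>i. 0 \<le> x i"
  shows "(\<Prod>i\<in>UNIV. x i) \<le> ((\<Sum>i\<in>UNIV. x i) / 6) ^ 6"
proof -
  have p: "0 \<le> (\<Prod>i\<in>UNIV. x i)"
    using assms by (simp add: prod_nonneg)
  have "(\<Prod>i\<in>UNIV. x i) powr (1 / 6) \<le> (\<Sum>i\<in>UNIV. x i) / 6"
    using arith_geom_mean[of "UNIV :: 6 set" x] assms by (simp add: sum_divide_distrib)
  then have "((\<Prod>i\<in>UNIV. x i) powr (1 / 6)) ^ 6 \<le> ((\<Sum>i\<in>UNIV. x i) / 6) ^ 6"
    by (rule power_mono) simp
  moreover have "(y powr (1 / 6)) ^ 6 = y" if "0 \<le> y" for y :: real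
    using that by (cases "y = 0") (simp_all add: powr_power)
  then have "((\<Prod>i\<in>UNIV. x i) powr (1 / 6)) ^ 6 = (\<Prod>i\<in>UNIV. x i)"
    using p .
  ultimately show ?thesis
    by (simp only:)
qed

lemma covers_near_det:
  assumes P: "P \<in> covers_near m"
  shows "rad ^ 6 * det P \<le> tau * m ^ 6"
proof -
  have "P \<in> PQF"
    using P by (simp add: covers_near_def)
  note pos = PQF_diagonal_pos[OF this]
  have t: "0 < tau" and r: "0 < rad"
    using tau_bounds by (simp_all add: rad_def)
  \<comment> \<open>Dividing the first diagonal entry by \<open>tau\<close> turns the trace bound
    into a plain sum and makes all six numbers equal at \<open>diag_form\<close>, where the
    arithmetic-geometric inequality is sharp.\<close>
  define x where "x i = (if i = 1 then P $ i $ i / tau else P $ i $ i)" for i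
  have "0 < x i" for i
    unfolding x_def using pos[of i] t by (auto intro: divide_pos_pos)
  then have x: "0 \<le> x i" for i
    by (rule less_imp_le)
  have "(\<Prod>i\<in>UNIV. P $ i $ i) = tau * (\<Prod>i\<in>UNIV. x i)"
    using t by (simp add: prod_6 x_def)
  then have "det P \<le> tau * (\<Prod>i\<in>UNIV. x i)"
    using PQF_det_le_prod_diagonal[OF \<open>P \<in> PQF\<close>] by simp
  also have "\<dots> \<le> tau * ((\<Sum>i\<in>UNIV. x i) / 6) ^ 6"
    using arith_geom_6[OF x] t by (intro mult_left_mono) simp_all
  finally have "rad ^ 6 * det P \<le> rad ^ 6 * (tau * ((\<Sum>i\<in>UNIV. x i) / 6) ^ 6)"
    using r by (intro mult_left_mono) simp_all
  also have "\<dots> = tau * (rad / 6 * (\<Sum>i\<in>UNIV. x i)) ^ 6"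
    by (simp add: power_mult_distrib power_divide)
  also have "\<dots> \<le> tau * m ^ 6"
  proof (intro mult_left_mono power_mono)
    show "rad / 6 * (\<Sum>i\<in>UNIV. x i) \<le> m"
      using covers_near_ge[OF P] by (simp add: sum_6 x_def)
    show "0 \<le> rad / 6 * (\<Sum>i\<in>UNIV. x i)"
      using r x by (simp add: sum_nonneg)
  qed (use t in simp)
  finally show ?thesis .
qed

text \<open>\<open>F\<close> undoes the change of coordinates. It is continuous and takes
  \<open>Q6c2\<close> to \<open>diag_form\<close>, so nearby forms land in the entrywise
  neighbourhood of \<open>covers_near\<close>. Powers of \<open>scl\<close> cancel since both sides
  have degree six, and 4096 is the square of 64.\<close>

lemma mu_lower_bound_near:
  "\<exists>\<epsilon>>0. \<forall>Q\<in>PQF. dist Q Q6c2 < \<epsilon> \<longrightarrow> rad ^ 6 * det Q \<le> 4096 * tau * mu Q ^ 6"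
proof -
  obtain S where S: "S ** T6 = mat 1" "T6 ** S = mat 1"
    using T6_inverse .
  have scl0: "scl \<noteq> 0"
    using scl(3) by simp
  define F where "F Q = (1 / scl) *\<^sub>R (transpose S ** Q ** S)" for Q
  have ST: "S *v (T6 *v x) = x" "T6 *v (S *v x) = x" for x
    using S by (simp_all add: matrix_vector_mul_assoc)
  have "transpose S ** (transpose T6 ** diag_form ** T6) ** S
      = transpose (T6 ** S) ** diag_form ** (T6 ** S)"
    by (simp add: matrix_transpose_mul matrix_mul_assoc)
  then have F0: "F Q6c2 = diag_form"
    using S scl0
    by (simp add: F_def Q6c2_eq matrix_scalar_ac transpose_mat flip: scalar_matrix_assoc)
  have "isCont (\<lambda>Q. F Q $ i $ j) Q6c2" for i j
    using scl0 unfolding F_def matrix_matrix_mult_def by (auto intro!: continuous_intros)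
  then have "((\<lambda>Q. F Q $ i $ j) \<longlongrightarrow> F Q6c2 $ i $ j) (nhds Q6c2)" for i j
    using tendsto_at_iff_tendsto_nhds[of "\<lambda>Q. F Q $ i $ j" Q6c2] unfolding isCont_def by blast
  then have "\<forall>\<^sub>F Q in nhds Q6c2. dist (F Q $ i $ j) (F Q6c2 $ i $ j) < 1 / 10 ^ 6" for i j
    by (rule tendstoD) simp
  then have "\<forall>\<^sub>F Q in nhds Q6c2. \<forall>i j. dist (F Q $ i $ j) (F Q6c2 $ i $ j) < 1 / 10 ^ 6"
    by (intro eventually_all_finite)
  then obtain \<epsilon> where \<epsilon>: "\<epsilon> > 0"
    "\<And>Q i j. dist Q Q6c2 < \<epsilon> \<Longrightarrow> dist (F Q $ i $ j) (F Q6c2 $ i $ j) < 1 / 10 ^ 6"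
    unfolding eventually_nhds_metric by blast
  have "rad ^ 6 * det Q \<le> 4096 * tau * mu Q ^ 6" if Q: "Q \<in> PQF" and near: "dist Q Q6c2 < \<epsilon>" for Q
  proof -
    have "F Q \<in> covers_near (mu Q / scl)"
      unfolding covers_near_def
    proof (intro CollectI conjI allI)
      show "F Q \<in> PQF"
        unfolding F_def
      proof (intro PQF_scaleR PQF_congruence Q)
        show "x = 0" if "S *v x = 0" for x
          using ST(2)[of x] that by simp
      qed (use scl(3) in simp)
      show "\<bar>F Q $ i $ j - diag_form $ i $ j\<bar> \<le> 1 / 10 ^ 6" for i j
        using \<epsilon>(2)[OF near, of i j] unfolding F0 dist_real_def by (rule less_imp_le)
      show "\<exists>v\<in>D6_lattice. qform (F Q) (y - v) \<le> mu Q / scl" for y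
      proof -
        obtain v where v: "v \<in> int_lattice" "min_dist Q (S *v y) = qform Q (S *v y - v)"
          using min_dist_attained[OF Q] by blast
        have "S *v (y - T6 *v v) = S *v y - v"
          by (simp add: matrix_vector_mult_diff_distrib ST)
        then have "qform (F Q) (y - T6 *v v) = min_dist Q (S *v y) / scl"
          by (simp add: F_def qform_scaleR qform_congruence v(2))
        also have "\<dots> \<le> mu Q / scl"
          using min_dist_le_mu[OF Q] scl(3) by (intro divide_right_mono) simp_all
        finally show ?thesis
          using T6_int_lattice[OF v(1)] by blast
      qed
    qed
    then have le: "rad ^ 6 * det (F Q) \<le> tau * (mu Q / scl) ^ 6"
      by (rule covers_near_det)
    have "det S * det T6 = 1"
      using S(1) by (metis det_I det_mul)
    then have "det S = - 1 / 64"
      unfolding det_T6 by simp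
    then have "det (F Q) = det Q / (4096 * scl ^ 6)"
      unfolding F_def det_scaleR det_mul det_transpose by (simp add: power_divide)
    with le scl(3) show ?thesis
      by (simp add: power_divide field_simps)
  qed
  then show ?thesis
    using \<epsilon>(1) by blast
qed

lemma mu_nonneg:
  fixes Q :: "real^'n^'n"
  assumes "Q \<in> PQF"
  shows "0 \<le> mu Q"
  using mu_attained[OF assms] min_dist_attained[OF assms] qform_nonneg[OF assms] by metis

text \<open>The lower bound applies in particular at the centre of its neighbourhood, where it meets
  the upper bound from the covering.\<close>

lemma mu_det_Q6c2: "mu Q6c2 ^ 6 / det Q6c2 = rad ^ 6 / (4096 * tau)"
proof -
  have t: "0 < tau"
    using tau_bounds by simp
  obtain \<epsilon> where "\<epsilon> > 0" "\<And>Q. Q \<in> PQF \<Longrightarrow> dist Q Q6c2 < \<epsilon> \<Longrightarrow> rad ^ 6 * det Q \<le> 4096 * tau * mu Q ^ 6"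
    using mu_lower_bound_near by blast
  then have "rad ^ 6 * det Q6c2 \<le> 4096 * tau * mu Q6c2 ^ 6"
    using Q6c2_PQF by simp
  then have "rad ^ 6 / (4096 * tau) \<le> mu Q6c2 ^ 6 / det Q6c2"
    using t PQF_det_pos[OF Q6c2_PQF] by (simp add: field_simps)
  moreover have "mu Q6c2 ^ 6 \<le> (scl * rad) ^ 6"
    using mu_Q6c2_le mu_nonneg[OF Q6c2_PQF] by (rule power_mono)
  then have "mu Q6c2 ^ 6 / det Q6c2 \<le> (scl * rad) ^ 6 / det Q6c2"
    using PQF_det_pos[OF Q6c2_PQF] by (intro divide_right_mono) simp_all
  moreover have "(scl * rad) ^ 6 / det Q6c2 = rad ^ 6 / (4096 * tau)"
    using scl(3) t unfolding det_Q6c2 by (simp add: power_mult_distrib field_simps)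
  ultimately show ?thesis
    by simp
qed

lemma locally_optimal_Q6c2: "locally_optimal_covering Q6c2"
proof -
  have t: "0 < tau"
    using tau_bounds by simp
  obtain \<epsilon> where \<epsilon>: "\<epsilon> > 0"
    "\<And>Q. Q \<in> PQF \<Longrightarrow> dist Q Q6c2 < \<epsilon> \<Longrightarrow> rad ^ 6 * det Q \<le> 4096 * tau * mu Q ^ 6"
    using mu_lower_bound_near by blast
  have "Theta Q6c2 \<le> Theta Q" if Q: "Q \<in> PQF" "dist Q Q6c2 < \<epsilon>" for Q
  proof -
    have "rad ^ 6 / (4096 * tau) \<le> mu Q ^ 6 / det Q"
      using \<epsilon>(2)[OF Q] t PQF_det_pos[OF Q(1)] by (simp add: field_simps)
    then show ?thesis
      unfolding Theta_def by (intro mult_right_mono) (simp_all add: mu_det_Q6c2)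
  qed
  then show ?thesis
    unfolding locally_optimal_covering_def using Q6c2_PQF \<epsilon>(1) by blast
qed

section \<open>The covering density in closed form\<close>

lemma Theta_Q6c2:
  "Theta Q6c2 = sqrt (1124895337698 * sqrt 1057 - 33713139497730) / 3543122 * unit_ball_vol 6"
proof -
  define s :: real where "s = sqrt 1057"
  have s2: "s * s = 1057" and "0 < s"
    by (simp_all add: s_def)
  have rad: "rad = 2 * (197 - s) / 121"
    unfolding rad_def tau_def s_def by (simp add: field_simps)
  have sq: "(197 - s) ^ 2 = 39866 - 394 * s"
    using s2 by (simp add: power2_eq_square algebra_simps)
  have "(197 - s) ^ 6 = ((197 - s) ^ 2) ^ 3"
    by simp
  also have "\<dots> = (39866 - 394 * s) * ((39866 - 394 * s) * (39866 - 394 * s))"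
    unfolding sq by (simp add: power3_eq_cube)
  also have "(39866 - 394 * s) * (39866 - 394 * s) = 39866 ^ 2 + 394 ^ 2 * (s * s) - 2 * 39866 * 394 * s"
    by (simp add: algebra_simps power2_eq_square)
  also have "(39866 - 394 * s) * (39866 ^ 2 + 394 ^ 2 * (s * s) - 2 * 39866 * 394 * s)
    = (39866 * (39866 ^ 2 + 394 ^ 2 * 1057) + 394 * (2 * 39866 * 394) * (s * s))
      - (394 * (39866 ^ 2 + 394 ^ 2 * 1057) + 39866 * (2 * 39866 * 394)) * s"
    unfolding s2 by (simp add: algebra_simps s2)
  finally have "(197 - s) ^ 6 = (39866 * (39866 ^ 2 + 394 ^ 2 * 1057) + 394 * (2 * 39866 * 394) * 1057)
      - (394 * (39866 ^ 2 + 394 ^ 2 * 1057) + 39866 * (2 * 39866 * 394)) * s"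
    unfolding s2 .
  then have s6: "(197 - s) ^ 6 = 82983124604192 - 1943199458080 * s"
    by simp
  have rad6: "rad ^ 6 = 64 * (197 - s) ^ 6 / 121 ^ 6"
    unfolding rad power_divide power_mult_distrib by simp
  have frac: "(64 * x / a) / (b * (y / 231)) = (64 * 231 * x) / (a * b * y)" for x y a b :: real
    by simp
  have "rad ^ 6 / (4096 * tau) = (64 * 231 * (197 - s) ^ 6) / (121 ^ 6 * 4096 * (35 + 2 * s))"
    unfolding rad6 tau_def s_def[symmetric] by (rule frac)
  \<comment> \<open>The denominator is 3543122 = 2 * 11^6, whose square is 4 * 121^6. The right-hand
    numerator comes from rationalising \<open>35 + 2 * s\<close>; cross multiplication verifies
    it.\<close>
  also have "\<dots> = (1124895337698 * s - 33713139497730) / 3543122 ^ 2"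
  proof (subst frac_eq_eq)
    have "(1124895337698 * s - 33713139497730) * (35 + 2 * s)
        = 2 * 1124895337698 * (s * s) + (35 * 1124895337698 - 2 * 33713139497730) * s - 35 * 33713139497730"
      by (simp add: algebra_simps)
    also have "\<dots> = 1198068861473022 - 28054942176030 * s"
      unfolding s2 by simp
    finally have e: "(1124895337698 * s - 33713139497730) * (35 + 2 * s) = 1198068861473022 - 28054942176030 * s" .
    have "(1124895337698 * s - 33713139497730) * (121 ^ 6 * 4096 * (35 + 2 * s))
        = 121 ^ 6 * 4096 * (1198068861473022 - 28054942176030 * s)"
      by (subst mult.left_commute) (simp only: e)
    then show "64 * 231 * (197 - s) ^ 6 * 3543122 ^ 2
        = (1124895337698 * s - 33713139497730) * (121 ^ 6 * 4096 * (35 + 2 * s))"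
      unfolding s6 by simp
  qed (use \<open>0 < s\<close> in simp_all)
  finally have "rad ^ 6 / (4096 * tau) = (1124895337698 * s - 33713139497730) / 3543122 ^ 2" .
  then have "mu Q6c2 ^ 6 / det Q6c2 = (1124895337698 * s - 33713139497730) / 3543122 ^ 2"
    unfolding mu_det_Q6c2 .
  moreover have "Theta Q6c2 = sqrt (mu Q6c2 ^ 6 / det Q6c2) * unit_ball_vol 6"
    by (simp add: Theta_def)
  ultimately have "Theta Q6c2 = sqrt ((1124895337698 * s - 33713139497730) / 3543122 ^ 2) * unit_ball_vol 6"
    by (simp only:)
  then show ?thesis
    unfolding s_def real_sqrt_divide by (simp only: real_sqrt_abs abs_numeral)
qed

section \<open>Numerical value\<close>

lemma arctan_partial_sums:
  fixes x :: real
  assumes "0 < x" "x \<le> 1"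
  shows "(\<Sum>k<2 * n. (- 1) ^ k * (1 / real (k * 2 + 1) * x ^ (k * 2 + 1))) \<le> arctan x"
    "arctan x \<le> (\<Sum>k<2 * n + 1. (- 1) ^ k * (1 / real (k * 2 + 1) * x ^ (k * 2 + 1)))"
proof -
  have x: "\<bar>x\<bar> \<le> 1"
    using assms by simp
  have "0 < 1 / real (0 * 2 + 1) * x ^ (0 * 2 + 1)"
    using assms by simp
  from mp[OF summable_Leibniz(2)[OF zeroseq_arctan_series[OF x] monoseq_arctan_series[OF x]] this, THEN spec, of n]
  show "(\<Sum>k<2 * n. (- 1) ^ k * (1 / real (k * 2 + 1) * x ^ (k * 2 + 1))) \<le> arctan x"
    "arctan x \<le> (\<Sum>k<2 * n + 1. (- 1) ^ k * (1 / real (k * 2 + 1) * x ^ (k * 2 + 1)))"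
    unfolding arctan_series[OF x] by simp_all
qed

text \<open>In Euler's formula pi / 4 = 5 arctan (1/7) + 2 arctan (3/79) the alternating series
  converge so fast that at most nine and six terms fix 13 decimals.\<close>

lemma pi_bounds: "31415926535897 / 10 ^ 13 < pi" "pi < 31415926535898 / 10 ^ 13"
proof -
  have pi: "pi = 20 * arctan (1 / 7) + 8 * arctan (3 / 79)"
    using machin_Euler by simp
  have a: "(\<Sum>k<2 * 4. (- 1) ^ k * (1 / real (k * 2 + 1) * (1 / 7) ^ (k * 2 + 1))) \<le> arctan (1 / 7)"
    "arctan (1 / 7) \<le> (\<Sum>k<2 * 4 + 1. (- 1) ^ k * (1 / real (k * 2 + 1) * (1 / 7) ^ (k * 2 + 1)))"
    by (rule arctan_partial_sums; simp)+
  have b: "(\<Sum>k<2 * 3. (- 1) ^ k * (1 / real (k * 2 + 1) * (3 / 79) ^ (k * 2 + 1))) \<le> arctan (3 / 79)"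
    "arctan (3 / 79) \<le> (\<Sum>k<2 * 2 + 1. (- 1) ^ k * (1 / real (k * 2 + 1) * (3 / 79) ^ (k * 2 + 1)))"
    by (rule arctan_partial_sums; simp)+
  have "31415926535897 / 10 ^ 13 < 20 * (\<Sum>k<2 * 4. (- 1) ^ k * (1 / real (k * 2 + 1) * (1 / 7) ^ (k * 2 + 1)))
      + 8 * (\<Sum>k<2 * 3. (- 1) ^ k * (1 / real (k * 2 + 1) * (3 / 79) ^ (k * 2 + 1 :: nat)) :: real)"
    by (simp add: lessThan_nat_numeral eval_nat_numeral)
  then show "31415926535897 / 10 ^ 13 < pi"
    unfolding pi using a b by simp
  have "20 * (\<Sum>k<2 * 4 + 1. (- 1) ^ k * (1 / real (k * 2 + 1) * (1 / 7) ^ (k * 2 + 1)))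
      + 8 * (\<Sum>k<2 * 2 + 1. (- 1) ^ k * (1 / real (k * 2 + 1) * (3 / 79) ^ (k * 2 + 1 :: nat)) :: real)
      < 31415926535898 / 10 ^ 13"
    by (simp add: lessThan_nat_numeral eval_nat_numeral)
  then show "pi < 31415926535898 / 10 ^ 13"
    unfolding pi using a b by simp
qed

lemma Theta_value_bounds:
  "\<bar>sqrt (1124895337698 * sqrt 1057 - 33713139497730) / 3543122 * unit_ball_vol 6 - 2.466121650\<bar> < 2 / 10 ^ 9"
proof -
  define v where "v = sqrt (1124895337698 * sqrt 1057 - 33713139497730)"
  \<comment> \<open>An error of 10^-13 here is multiplied by about 10^12 under the outer root and
    divided by about 3 * 10^6 when that root is taken, so \<open>v\<close> is known to six
    decimals.\<close>
  have s: "325115364140177 / 10 ^ 13 < sqrt 1057" "sqrt 1057 < 325115364140178 / 10 ^ 13"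
    by (rule real_less_rsqrt real_less_lsqrt; simp add: power2_eq_square)+
  have v: "1690838914798 / 10 ^ 6 < v" "v < 1690838914799 / 10 ^ 6"
    unfolding v_def using s
    by (rule_tac [!] real_less_rsqrt real_less_lsqrt; simp add: power2_eq_square)+
  have "(31415926535897 / 10 ^ 13) ^ 3 \<le> pi ^ 3" "pi ^ 3 \<le> (31415926535898 / 10 ^ 13) ^ 3"
    using pi_bounds by (intro power_mono; simp)+
  then have V: "(31415926535897 / 10 ^ 13) ^ 3 / 6 \<le> unit_ball_vol 6"
    "unit_ball_vol 6 \<le> (31415926535898 / 10 ^ 13) ^ 3 / 6"
    using unit_ball_vol_even[of 3] by (simp_all add: fact_numeral)
  have "v * unit_ball_vol 6 \<le> 1690838914799 / 10 ^ 6 * ((31415926535898 / 10 ^ 13) ^ 3 / 6)"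
    using v V by (intro mult_mono) simp_all
  moreover have "1690838914798 / 10 ^ 6 * ((31415926535897 / 10 ^ 13) ^ 3 / 6) \<le> v * unit_ball_vol 6"
    using v V by (intro mult_mono) simp_all
  ultimately show ?thesis
    unfolding v_def[symmetric] abs_less_iff power3_eq_cube by simp
qed

theorem theorem11p7:
  shows "locally_optimal_covering Q6c2
    \<and> Theta Q6c2 =
        sqrt (1124895337698 * sqrt 1057 - 33713139497730) / 3543122 * unit_ball_vol 6
    \<and> \<bar>Theta Q6c2 - 2.466121650\<bar> < 2 / 10 ^ 9"
  using locally_optimal_Q6c2 Theta_Q6c2 Theta_value_bounds by (simp only: simp_thms)

end
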